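(* Let $r \geq 1$ and let $p_1,\dots,p_r$ be distinct odd primes. For $i=1,\dots,r$ and integers $n\geq 1$ define $$\alpha_i(n) := p_i^{\{n \log 2/\log p_i\} - 1},$$ and for integers $H \geq 1$ define $$U_i(H) := \left\{ \frac{d_1}{p_i} + \frac{d_2}{p_i^2} + \cdots + \frac{d_H}{p_i^H} : d_1,\dots,d_H \in \mathbb{Z},\ 0 \leq d_1,\dots,d_H \leq \frac{p_i}{3}\right\} + \left[0, \frac{1}{p_i^H}\right) \subseteq \mathbb{R}.$$ Then there is a function $H = H(N)$ of positive integers $N$, with $H(N)\to\infty$ as $N\to\infty$, such that for arbitrary sequences of real numbers $(\beta_i(n))_{n\geq 1}$, $i=1,\dots,r$, $$\frac{\#\{ n \leq N : \exists\, s \in \mathbb{Z},\ 1\leq s \leq 10^{10r^2H(N)},\ \forall\, j=1,\dots,r:\ \{ s\,\alpha_j(n) + \beta_j(n)\} \in U_j(H(N))\}}{N} \geq 1 - o(1)$$ as $N \to \infty$.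
   Context: For a real number $x$, $\{x\} = x - \lfloor x\rfloor$ denotes its fractional part. The sum of a set and an interval denotes the Minkowski sum $\{a+b : a \in A, b\in I\}$. *)

theory Defs
  imports Complex_Main "HOL-Computational_Algebra.Primes" "HOL-Library.Set_Algebras"
begin

definition alpha :: "nat \<Rightarrow> nat \<Rightarrow> real" where
  "alpha p n = real p powr (frac (real n * ln 2 / ln (real p)) - 1)"

text \<open>The addition of sets below is the Minkowski sum.\<close>

definition U :: "nat \<Rightarrow> nat \<Rightarrow> real set" where
  "U p H =
     {\<Sum>k=1..H. real_of_int (d k) / real p ^ k | d :: nat \<Rightarrow> int.
        \<forall>k\<in>{1..H}. 0 \<le> d k \<and> real_of_int (d k) \<le> real p / 3}
     + {0..<1 / real p ^ H}"

end

theory Submission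
  imports Defs "HOL-Analysis.Analysis" "HOL-Computational_Algebra.Polynomial"
begin

text \<open>
  Write e(x) for exp(2 pi i x). Nonnegative trigonometric polynomials, one for each prime, that have
  mean 1, absolutely bounded coefficient sum, no nonzero frequency divisible by p and are tiny off the
  allowed digits, are multiplied over all digits and all primes. The coefficient condition makes 0 the
  only combination of frequencies that vanishes, so some s at most S works for a given n (whatever the
  shifts beta are) as soon as the geometric sums of e(s (m_1 alpha_1(n) + ... + m_r alpha_r(n))) over
  s at most S are small on average over the finitely many nonzero integer vectors m that occur.

  Expanding the mean square over n of such a sum leaves averages of e(x_1 alpha_1(n) + ... + x_r alpha_r(n))
  in n. The points (n log 2 / log p_j) mod 1 may satisfy unknown linear relations, but by Kronecker's theorem
  their closure contains a line t v along which the numbers v_j log p_j are nonzero and distinct. Averaging n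
  over shifts that follow this line turns alpha_j into a piecewise multiple of exp(v_j log p_j t), and
  van der Corput's estimate bounds the resulting oscillatory integral by a negative power of max |x_j|.
\<close>

section \<open>Oscillatory integrals\<close>

text \<open>The exponent \<open>10 * r\<^sup>2 * H\<close> balances two losses. With
  \<open>r * H\<close> digit positions the coefficient sums multiply to at most 15 to the power
  \<open>r * H\<close>, so the saving, and with it \<open>T\<close>, has to be exponential in
  \<open>r * H\<close>. Among the derivatives of order 2 to \<open>r + 1\<close> of a phase made of
  \<open>r\<close> exponentials only one is known to be large, so van der Corput saves a factor
  \<open>T\<close> only for frequencies of size at least \<open>T ^ (r + 1)\<close>. Pairs of values
  of \<open>s\<close> closer than that are counted trivially, and \<open>S\<close> has to exceed
  \<open>T ^ (r + 1)\<close> by another exponential factor. One factor \<open>r\<close> thus comes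
  from the number of primes, the other from the order of the derivative.

  The constants in the bounds depend on the primes alone, whereas the point from which an average
  over \<open>n\<close> obeys its bound depends on \<open>H\<close> and on the frequencies without
  any control. For fixed \<open>H\<close> only finitely many frequencies occur, so such a point
  exists, but \<open>H\<close> can then only be found by a diagonal choice, with no rate of growth.
  The shifts beta merely multiply coefficients by unimodular factors, so no threshold depends on
  them.\<close>

lemma norm_integral_cis_first_derivative:
  fixes f f' f'' :: "real \<Rightarrow> real"
  assumes "a \<le> b" "\<tau> > 0"
    and D1: "\<And>t. (f has_real_derivative f' t) (at t)"
    and D2: "\<And>t. (f' has_real_derivative f'' t) (at t)"
    and lower: "\<And>t. t \<in> {a..b} \<Longrightarrow> f' t \<ge> \<tau>"
    and sign: "\<bar>\<sigma>\<bar> = 1" "\<And>t. t \<in> {a..b} \<Longrightarrow> \<sigma> * f'' t \<ge> 0"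
  shows "norm (integral {a..b} (\<lambda>t. cis (f t))) \<le> 4 / \<tau>"
proof -
  have pos: "f' t > 0" if "t \<in> {a..b}" for t
    using lower[OF that] \<open>\<tau> > 0\<close> by linarith
  \<comment> \<open>Integration by parts: \<open>F\<close> has derivative
    \<open>cis (f t) + E t\<close>. As \<open>f''\<close> keeps its sign, \<open>norm (E t)\<close>
    is the derivative of \<open>- \<sigma> / f' t\<close>, so the remainder integrates to boundary
    values, at most \<open>2 / \<tau>\<close> in total; the two values of \<open>F\<close> add
    \<open>1 / \<tau>\<close> each.\<close>
  define F where "F t = - \<i> * cis (f t) * complex_of_real (1 / f' t)" for t
  define E where "E t = \<i> * cis (f t) * complex_of_real (f'' t / (f' t)\<^sup>2)" for t
  have dcis: "((\<lambda>t. cis (f t)) has_vector_derivative (f' t *\<^sub>R (\<i> * cis (f t)))) (at t within S)" for t S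
    using has_derivative_cis[of f "(*) (f' t)" t S] D1[of t]
    by (simp add: has_vector_derivative_def has_field_derivative_def has_derivative_at_withinI scaleR_scaleR mult.commute)
  have drec: "((\<lambda>t. 1 / f' t) has_real_derivative - (f'' t / (f' t)\<^sup>2)) (at t within S)"
    if "t \<in> {a..b}" for t S
    using pos[OF that] 
    by (auto intro!: derivative_eq_intros has_field_derivative_at_within[OF D2] simp: power2_eq_square)
  have F: "(F has_vector_derivative (cis (f t) + E t)) (at t within {a..b})" if "t \<in> {a..b}" for t
  proof -
    have "((\<lambda>t. complex_of_real (1 / f' t)) has_vector_derivative complex_of_real (- (f'' t / (f' t)\<^sup>2))) (at t within {a..b})"
      using drec[OF that] by (intro has_vector_derivative_of_real) (simp add: has_real_derivative_iff_has_vector_derivative)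
    from has_vector_derivative_mult[OF has_vector_derivative_mult_right[OF dcis, of "-\<i>"] this]
    show ?thesis
      unfolding F_def E_def
      by (rule has_vector_derivative_eq_rhs) (use pos[OF that] in \<open>simp add: scaleR_conv_of_real field_simps\<close>)
  qed
  have cont: "continuous_on {a..b} (\<lambda>t. cis (f t))"
    by (rule continuous_on_vector_derivative) (rule dcis)
  define I where "I = integral {a..b} (\<lambda>t. cis (f t))"
  have I: "((\<lambda>t. cis (f t)) has_integral I) {a..b}"
    unfolding I_def using cont by (intro integrable_integral integrable_continuous_real)
  have EI: "(E has_integral (F b - F a - I)) {a..b}"
    using has_integral_diff[OF fundamental_theorem_of_calculus[OF \<open>a \<le> b\<close> F] I] by simp
  have G: "((\<lambda>t. \<sigma> * (f'' t / (f' t)\<^sup>2)) has_integral (- \<sigma> / f' b - (- \<sigma> / f' a))) {a..b}"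
  proof (rule fundamental_theorem_of_calculus[OF \<open>a \<le> b\<close>])
    fix t assume t: "t \<in> {a..b}"
    from DERIV_cmult[OF drec[OF t, of "{a..b}"], of "-\<sigma>"]
    show "((\<lambda>t. - \<sigma> / f' t) has_vector_derivative \<sigma> * (f'' t / (f' t)\<^sup>2)) (at t within {a..b})"
      by (simp add: has_real_derivative_iff_has_vector_derivative)
  qed
  have "norm (integral {a..b} E) \<le> integral {a..b} (\<lambda>t. \<sigma> * (f'' t / (f' t)\<^sup>2))"
  proof (rule integral_norm_bound_integral)
    fix t assume t: "t \<in> {a..b}"
    have "\<bar>f'' t\<bar> = \<sigma> * f'' t"
      using sign(2)[OF t] sign(1) by (metis abs_mult abs_of_nonneg mult_1)
    then show "norm (E t) \<le> \<sigma> * (f'' t / (f' t)\<^sup>2)"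
      by (simp add: E_def norm_mult norm_divide abs_mult norm_power)
  qed (use EI G in auto)
  then have "norm (F b - F a - I) \<le> \<sigma> / f' a - \<sigma> / f' b"
    using EI G by (simp add: integral_unique)
  moreover have nF: "norm (F t) \<le> 1 / \<tau>" "\<bar>\<sigma> / f' t\<bar> \<le> 1 / \<tau>" if "t \<in> {a..b}" for t
    using pos[OF that] lower[OF that] \<open>\<tau> > 0\<close> sign(1)
    by (auto simp: F_def norm_mult norm_divide frac_le)
  ultimately have "norm (F b - F a - I) \<le> 2 / \<tau>"
    using abs_le_D1[OF nF(2)[of a]] abs_le_D2[OF nF(2)[of b]] \<open>a \<le> b\<close> by (simp del: abs_divide)
  moreover have "norm I \<le> norm (F b - F a - I) + norm (F b) + norm (F a)"
    by (smt (verit) norm_triangle_ineq4 norm_minus_commute norm_triangle_ineq2)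
  ultimately show ?thesis
    using nF(1)[of a] nF(1)[of b] \<open>a \<le> b\<close> unfolding I_def by auto
qed

text \<open>Here \<open>\<phi> k\<close> is the \<open>k\<close>-th derivative of the phase \<open>\<phi> 0\<close>. The lower bound is written as
  a power of \<open>\<tau>\<close> so that the estimate needs no fractional exponents.\<close>

lemma van_der_corput:
  fixes \<phi> :: "nat \<Rightarrow> real \<Rightarrow> real"
  assumes "\<And>k t. (\<phi> k has_real_derivative \<phi> (Suc k) t) (at t)"
    and "\<tau> > 0" "a \<le> b"
    and "\<And>t. t \<in> {a..b} \<Longrightarrow> \<phi> (Suc k) t \<ge> \<tau> ^ Suc k"
    and "k = 0 \<Longrightarrow> (\<exists>\<sigma>. \<bar>\<sigma>\<bar> = 1 \<and> (\<forall>t\<in>{a..b}. \<sigma> * \<phi> 2 t \<ge> 0))"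
  shows "norm (integral {a..b} (\<lambda>t. cis (\<phi> 0 t))) \<le> (6 * 2 ^ k - 2) / \<tau>"
  using assms
proof (induction k arbitrary: \<phi> a b)
  case 0
  then obtain \<sigma> :: real where "\<bar>\<sigma>\<bar> = 1" "\<forall>t\<in>{a..b}. \<sigma> * \<phi> 2 t \<ge> 0"
    by auto
  then show ?case
    using norm_integral_cis_first_derivative[of a b \<tau> "\<phi> 0" "\<phi> 1" "\<phi> 2" \<sigma>] 0
    by (simp add: numeral_2_eq_2)
next
  case (Suc k)
  define I where "I x y = integral {x..y} (\<lambda>t. cis (\<phi> 0 t))" for x y
  define \<psi> where "\<psi> = \<phi> (Suc k)"
  have int: "(\<lambda>t. cis (\<phi> 0 t)) integrable_on {x..y}" for x y
  proof (rule integrable_continuous_real)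
    have "continuous_on {x..y} (\<phi> 0)"
      by (rule DERIV_continuous_on) (rule has_field_derivative_at_within[OF Suc.prems(1)])
    then show "continuous_on {x..y} (\<lambda>t. cis (\<phi> 0 t))"
      unfolding cis_conv_exp by (intro continuous_intros)
  qed
  have upper: "norm (I x y) \<le> (6 * 2 ^ k - 2) / \<tau>"
    if "a \<le> x" "x \<le> y" "y \<le> b" and "\<And>t. t \<in> {x..y} \<Longrightarrow> \<psi> t \<ge> \<tau> ^ Suc k" for x y
    unfolding I_def
  proof (rule Suc.IH[of \<phi>])
    \<comment> \<open>The sign condition of the base case is supplied by the positive lower bound on
      the next derivative.\<close>
    assume "k = 0"
    moreover have "0 \<le> \<phi> (Suc (Suc k)) t" if "t \<in> {x..y}" for t
      using Suc.prems(2) Suc.prems(4)[of t] that \<open>a \<le> x\<close> \<open>y \<le> b\<close>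
      by (smt (verit) atLeastAtMost_iff zero_less_power)
    ultimately show "\<exists>\<sigma>. \<bar>\<sigma>\<bar> = 1 \<and> (\<forall>t\<in>{x..y}. 0 \<le> \<sigma> * \<phi> 2 t)"
      by (intro exI[of _ 1]) (simp add: numeral_2_eq_2)
  qed (use that Suc.prems(1,2) in \<open>auto simp: \<psi>_def\<close>)
  have lower: "norm (I x y) \<le> (6 * 2 ^ k - 2) / \<tau>"
    if "a \<le> x" "x \<le> y" "y \<le> b" and "\<And>t. t \<in> {x..y} \<Longrightarrow> \<psi> t \<le> - (\<tau> ^ Suc k)" for x y
  proof -
    have "norm (integral {x..y} (\<lambda>t. cis (- \<phi> 0 t))) \<le> (6 * 2 ^ k - 2) / \<tau>"
    proof (rule Suc.IH[of "\<lambda>k t. - \<phi> k t"])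
      assume "k = 0"
      moreover have "0 \<le> \<phi> (Suc (Suc k)) t" if "t \<in> {x..y}" for t
        using Suc.prems(2) Suc.prems(4)[of t] that \<open>a \<le> x\<close> \<open>y \<le> b\<close>
        by (smt (verit) atLeastAtMost_iff zero_less_power)
      ultimately show "\<exists>\<sigma>. \<bar>\<sigma>\<bar> = 1 \<and> (\<forall>t\<in>{x..y}. 0 \<le> \<sigma> * - \<phi> 2 t)"
        by (intro exI[of _ "-1"]) (simp add: numeral_2_eq_2)
    next
      fix t assume "t \<in> {x..y}"
      then show "\<tau> ^ Suc k \<le> - \<phi> (Suc k) t"
        using that(4)[of t] by (simp add: \<psi>_def)
    qed (use that(1-3) Suc.prems(1,2) in \<open>auto intro!: derivative_eq_intros\<close>)
    also have "integral {x..y} (\<lambda>t. cis (- \<phi> 0 t)) = cnj (I x y)"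
      by (simp add: I_def integral_cnj cis_cnj)
    finally show ?thesis by simp
  qed
  have growth: "\<psi> y - \<psi> x \<ge> \<tau> ^ Suc (Suc k) * (y - x)" if "a \<le> x" "x \<le> y" "y \<le> b" for x y
  proof -
    define g where "g t = \<psi> t - \<tau> ^ Suc (Suc k) * t" for t
    have "g x \<le> g y"
    proof (rule DERIV_nonneg_imp_nondecreasing[OF \<open>x \<le> y\<close>])
      fix t assume t: "x \<le> t" "t \<le> y"
      have "(g has_real_derivative (\<phi> (Suc (Suc k)) t - \<tau> ^ Suc (Suc k))) (at t)"
        unfolding g_def \<psi>_def by (auto intro!: derivative_eq_intros Suc.prems(1))
      then show "\<exists>d. (g has_real_derivative d) (at t) \<and> 0 \<le> d"
        using Suc.prems(4)[of t] t that by force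
    qed
    then show ?thesis by (simp add: g_def algebra_simps)
  qed
  \<comment> \<open>\<open>c\<close> is a zero of the increasing function \<open>\<psi>\<close>, or
    the endpoint where \<open>\<psi>\<close> comes closest to 0 if it keeps one sign.\<close>
  have "\<exists>c\<in>{a..b}. (\<forall>t\<in>{a..<c}. \<psi> t \<le> - (\<tau> ^ Suc (Suc k) * (c - t))) \<and>
            (\<forall>t\<in>{c<..b}. \<psi> t \<ge> \<tau> ^ Suc (Suc k) * (t - c))"
  proof -
    consider "\<psi> a \<ge> 0" | "\<psi> b \<le> 0" | "\<psi> a \<le> 0" "\<psi> b \<ge> 0" by linarith
    then show ?thesis
    proof cases
      case 1
      then show ?thesis
      proof (intro bexI[of _ a] conjI ballI)
        fix t assume "t \<in> {a<..b}"
        then show "\<psi> t \<ge> \<tau> ^ Suc (Suc k) * (t - a)" using growth[of a t] 1 by simp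
      qed (use \<open>a \<le> b\<close> in auto)
    next
      case 2
      then show ?thesis
      proof (intro bexI[of _ b] conjI ballI)
        fix t assume "t \<in> {a..<b}"
        then show "\<psi> t \<le> - (\<tau> ^ Suc (Suc k) * (b - t))" using growth[of t b] 2 by simp
      qed (use \<open>a \<le> b\<close> in auto)
    next
      case 3
      have "\<exists>c. a \<le> c \<and> c \<le> b \<and> \<psi> c = 0"
        using 3 \<open>a \<le> b\<close> Suc.prems(1) unfolding \<psi>_def
        by (intro IVT) (auto intro: DERIV_isCont)
      then obtain c where c: "a \<le> c" "c \<le> b" "\<psi> c = 0" by blast
      show ?thesis
      proof (intro bexI[of _ c] conjI ballI)
        fix t assume "t \<in> {a..<c}"
        then show "\<psi> t \<le> - (\<tau> ^ Suc (Suc k) * (c - t))" using growth[of t c] c by simp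
      next
        fix t assume "t \<in> {c<..b}"
        then show "\<psi> t \<ge> \<tau> ^ Suc (Suc k) * (t - c)" using growth[of c t] c by simp
      qed (use c in auto)
    qed
  qed
  then obtain c where c: "c \<in> {a..b}"
    and cl: "\<And>t. t \<in> {a..<c} \<Longrightarrow> \<psi> t \<le> - (\<tau> ^ Suc (Suc k) * (c - t))"
    and cu: "\<And>t. t \<in> {c<..b} \<Longrightarrow> \<psi> t \<ge> \<tau> ^ Suc (Suc k) * (t - c)"
    by blast
  \<comment> \<open>Off the interval of radius \<open>1 / \<tau>\<close> about \<open>c\<close> the previous derivative is large.\<close>
  define x where "x = max a (c - 1 / \<tau>)"
  define y where "y = min b (c + 1 / \<tau>)"
  have inv: "1 / \<tau> > 0" and pow: "\<tau> ^ Suc (Suc k) * (1 / \<tau>) = \<tau> ^ Suc k"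
    using \<open>\<tau> > 0\<close> by auto
  have xy: "a \<le> x" "x \<le> c" "c \<le> y" "y \<le> b" "y - x \<le> 2 / \<tau>"
    using c inv by (auto simp: x_def y_def)
  have nneg: "(6 * 2 ^ k - 2) / \<tau> \<ge> 0"
    using \<open>\<tau> > 0\<close> one_le_power[of "2::real" k] by (intro divide_nonneg_pos) linarith+
  have L: "norm (I a x) \<le> (6 * 2 ^ k - 2) / \<tau>"
  proof (cases "a = x")
    case True
    then show ?thesis using nneg by (simp add: I_def)
  next
    case False
    then have xc: "x = c - 1 / \<tau>" by (auto simp: x_def)
    show ?thesis
    proof (rule lower)
      fix t assume t: "t \<in> {a..x}"
      then have "\<tau> ^ Suc (Suc k) * (1 / \<tau>) \<le> \<tau> ^ Suc (Suc k) * (c - t)"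
        using xc \<open>\<tau> > 0\<close> by (intro mult_left_mono) auto
      then show "\<psi> t \<le> - (\<tau> ^ Suc k)"
        using cl[of t] t xc inv unfolding pow atLeastAtMost_iff atLeastLessThan_iff by linarith
    qed (use xy in auto)
  qed
  have R: "norm (I y b) \<le> (6 * 2 ^ k - 2) / \<tau>"
  proof (cases "y = b")
    case True
    then show ?thesis using nneg by (simp add: I_def)
  next
    case False
    then have yc: "y = c + 1 / \<tau>" by (auto simp: y_def)
    show ?thesis
    proof (rule upper)
      fix t assume t: "t \<in> {y..b}"
      then have "\<tau> ^ Suc (Suc k) * (1 / \<tau>) \<le> \<tau> ^ Suc (Suc k) * (t - c)"
        using yc \<open>\<tau> > 0\<close> by (intro mult_left_mono) auto
      then show "\<psi> t \<ge> \<tau> ^ Suc k"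
        using cu[of t] t yc inv unfolding pow atLeastAtMost_iff greaterThanAtMost_iff by linarith
    qed (use xy in auto)
  qed
  have M: "norm (I x y) \<le> 2 / \<tau>"
  proof -
    have "norm (I x y) \<le> 1 * (y - x)"
      using has_integral_bound[of 1 "\<lambda>t. cis (\<phi> 0 t)" "I x y" x y] int[of x y] xy
      by (auto simp: I_def integrable_integral)
    then show ?thesis using xy by simp
  qed
  have "I a x + I x y = I a y"
    unfolding I_def by (rule Henstock_Kurzweil_Integration.integral_combine[OF _ _ int]) (use xy in auto)
  moreover have "I a y + I y b = I a b"
    unfolding I_def by (rule Henstock_Kurzweil_Integration.integral_combine[OF _ _ int]) (use xy in auto)
  ultimately have "I a b = I a x + I x y + I y b" by simp
  then have "norm (I a b) \<le> norm (I a x) + norm (I x y) + norm (I y b)"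
    by (metis norm_triangle_ineq norm_triangle_mono order_refl)
  \<comment> \<open>The constants obey c_0 = 4 and c_(k+1) = 2 c_k + 2, solved by
    \<open>6 * 2 ^ k - 2\<close>.\<close>
  also have "\<dots> \<le> 2 * ((6 * 2 ^ k - 2) / \<tau>) + 2 / \<tau>"
    using L M R by linarith
  also have "\<dots> = (6 * 2 ^ Suc k - 2) / \<tau>"
    using \<open>\<tau> > 0\<close> by (simp add: field_simps)
  finally show ?case by (simp add: I_def)
qed

lemma exp_sum_some_derivative_large:
  fixes \<mu> :: "nat \<Rightarrow> real"
  assumes "finite J" "inj_on \<mu> J" "\<And>j. j \<in> J \<Longrightarrow> \<mu> j \<noteq> 0" "i \<in> J"
  shows "\<exists>c>0. \<forall>A t. t \<in> {0..1} \<longrightarrow>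
    (\<exists>k\<in>{2..card J + 1}. \<bar>\<Sum>j\<in>J. A j * \<mu> j ^ k * exp (\<mu> j * t)\<bar> \<ge> c * \<bar>A i\<bar>)"
proof -
  \<comment> \<open>A Lagrange polynomial: the combination of the derivatives with its coefficients isolates the term \<open>i\<close>.\<close>
  define q where "q = [:0, 0, 1:] * (\<Prod>j\<in>J - {i}. [:- \<mu> j, 1:])"
  have "degree (\<Prod>j\<in>J - {i}. [:- \<mu> j, 1:]) = card J - 1"
    using assms by (simp add: degree_prod_eq_sum_degree)
  moreover have "(\<Prod>j\<in>J - {i}. [:- \<mu> j, 1:]) \<noteq> 0"
    using assms(1) by (simp add: prod_zero_iff)
  moreover have "card J \<ge> 1"
    using assms(1,4) by (metis One_nat_def Suc_leI card_gt_0_iff empty_iff)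
  ultimately have deg: "degree q = card J + 1"
    unfolding q_def by (subst degree_mult_eq) auto
  \<comment> \<open>The factor x^2 of \<open>q\<close> confines the combination to derivatives of
    order at least 2, for which \<open>van_der_corput\<close> asks for no sign condition.\<close>
  have low: "coeff q 0 = 0" "coeff q 1 = 0"
    by (simp_all add: q_def coeff_pCons split: nat.split)
  have qj: "poly q (\<mu> j) = 0" if "j \<in> J" "j \<noteq> i" for j
    using that assms(1) by (auto simp: q_def poly_prod prod_zero_iff)
  have qi: "poly q (\<mu> i) \<noteq> 0"
    using assms by (auto simp: q_def poly_prod prod_zero_iff inj_on_def)
  define K where "K = {2..card J + 1}"
  have eval: "poly q x = (\<Sum>k\<in>K. coeff q k * x ^ k)" for x
  proof -
    have "poly q x = (\<Sum>k\<le>card J + 1. coeff q k * x ^ k)"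
      by (simp add: poly_altdef deg)
    also have "\<dots> = (\<Sum>k\<in>K. coeff q k * x ^ k)"
    proof (rule sum.mono_neutral_right)
      show "\<forall>k\<in>{..card J + 1} - K. coeff q k * x ^ k = 0"
      proof
        fix k assume "k \<in> {..card J + 1} - K"
        then have "k = 0 \<or> k = 1" by (auto simp: K_def)
        then show "coeff q k * x ^ k = 0" using low by auto
      qed
    qed (auto simp: K_def)
    finally show ?thesis .
  qed
  define S where "S = (\<Sum>k\<in>K. \<bar>coeff q k\<bar>)"
  have "S > 0"
  proof (rule ccontr)
    assume "\<not> S > 0"
    then have "S = 0" unfolding S_def by (metis abs_ge_zero linorder_not_le order_antisym_conv sum_nonneg)
    then have "\<forall>k\<in>K. coeff q k = 0"
      unfolding S_def by (subst (asm) sum_nonneg_eq_0_iff) (auto simp: K_def)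
    then show False using qi eval[of "\<mu> i"] by simp
  qed
  \<comment> \<open>On \<open>{0..1}\<close> the factor \<open>exp (\<mu> i * t)\<close> is at least
    \<open>exp (- \<bar>\<mu> i\<bar>)\<close>. Dividing by the total weight \<open>S\<close> passes
    from the combination to its largest member.\<close>
  define c where "c = \<bar>poly q (\<mu> i)\<bar> * exp (- \<bar>\<mu> i\<bar>) / S"
  have "c > 0" using \<open>S > 0\<close> qi by (simp add: c_def)
  moreover have "\<exists>k\<in>K. \<bar>\<Sum>j\<in>J. A j * \<mu> j ^ k * exp (\<mu> j * t)\<bar> \<ge> c * \<bar>A i\<bar>" if t: "t \<in> {0..1}" for A t
  proof (rule ccontr)
    define \<phi> where "\<phi> k = (\<Sum>j\<in>J. A j * \<mu> j ^ k * exp (\<mu> j * t))" for k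
    assume "\<not> ?thesis"
    then have small: "\<bar>\<phi> k\<bar> < c * \<bar>A i\<bar>" if "k \<in> K" for k using that by (auto simp: \<phi>_def)
    have "(\<Sum>k\<in>K. coeff q k * \<phi> k) = (\<Sum>j\<in>J. \<Sum>k\<in>K. coeff q k * (A j * \<mu> j ^ k * exp (\<mu> j * t)))"
      unfolding \<phi>_def sum_distrib_left by (rule sum.swap)
    also have "\<dots> = (\<Sum>j\<in>J. A j * exp (\<mu> j * t) * poly q (\<mu> j))"
      by (simp add: eval sum_distrib_left mult_ac)
    also have "\<dots> = (\<Sum>j\<in>{i}. A j * exp (\<mu> j * t) * poly q (\<mu> j))"
      using assms qj by (intro sum.mono_neutral_right) auto
    finally have eq: "(\<Sum>k\<in>K. coeff q k * \<phi> k) = A i * exp (\<mu> i * t) * poly q (\<mu> i)" by simp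
    have "\<bar>\<mu> i * t\<bar> \<le> \<bar>\<mu> i\<bar>"
      using t by (simp add: abs_mult mult_left_le)
    then have "- \<bar>\<mu> i\<bar> \<le> \<mu> i * t" by linarith
    then have "\<bar>A i\<bar> * (\<bar>poly q (\<mu> i)\<bar> * exp (- \<bar>\<mu> i\<bar>)) \<le> \<bar>A i\<bar> * (\<bar>poly q (\<mu> i)\<bar> * exp (\<mu> i * t))"
      by (intro mult_left_mono) auto
    also have "\<dots> = \<bar>\<Sum>k\<in>K. coeff q k * \<phi> k\<bar>"
      unfolding eq by (simp add: abs_mult)
    also have "\<dots> \<le> (\<Sum>k\<in>K. \<bar>coeff q k\<bar> * \<bar>\<phi> k\<bar>)"
      by (metis (no_types, lifting) abs_mult sum.cong sum_abs)
    also have "\<dots> < (\<Sum>k\<in>K. \<bar>coeff q k\<bar> * (c * \<bar>A i\<bar>))"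
    proof (rule sum_strict_mono_ex1)
      show "\<forall>k\<in>K. \<bar>coeff q k\<bar> * \<bar>\<phi> k\<bar> \<le> \<bar>coeff q k\<bar> * (c * \<bar>A i\<bar>)"
        using small by (auto intro!: mult_left_mono simp: less_imp_le)
      obtain k where "k \<in> K" "coeff q k \<noteq> 0"
        using qi eval[of "\<mu> i"] by (metis (no_types, lifting) mult_zero_left sum.neutral)
      then show "\<exists>k\<in>K. \<bar>coeff q k\<bar> * \<bar>\<phi> k\<bar> < \<bar>coeff q k\<bar> * (c * \<bar>A i\<bar>)"
        using small by (intro bexI[of _ k] mult_strict_left_mono) auto
    qed (simp add: K_def)
    also have "\<dots> = S * (c * \<bar>A i\<bar>)" by (simp add: S_def sum_distrib_right)
    also have "\<dots> = \<bar>A i\<bar> * (\<bar>poly q (\<mu> i)\<bar> * exp (- \<bar>\<mu> i\<bar>))"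
      using \<open>S > 0\<close> by (simp add: c_def)
    finally show False by simp
  qed
  ultimately show ?thesis unfolding K_def by blast
qed

text \<open>The order of the large derivative varies with \<open>t\<close> and \<open>A\<close> but
  never exceeds \<open>card J + 1\<close>. Since \<open>T \<ge> 1\<close>, the hypothesis with
  exponent \<open>card J + 1\<close> serves every order, and \<open>C\<close> depends on
  \<open>\<mu>\<close> and \<open>J\<close> only.\<close>

lemma exp_sum_oscillation_large:
  fixes \<mu> :: "nat \<Rightarrow> real"
  assumes "finite J" "inj_on \<mu> J" "\<And>j. j \<in> J \<Longrightarrow> \<mu> j \<noteq> 0"
  shows "\<exists>C\<ge>0. \<forall>A a b T i. i \<in> J \<longrightarrow> T \<ge> 1 \<longrightarrow> \<bar>A i\<bar> \<ge> T ^ (card J + 1) \<longrightarrow> 0 \<le> a \<longrightarrow> a \<le> b \<longrightarrow> b \<le> 1 \<longrightarrow>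
    norm (integral {a..b} (\<lambda>t. cis (\<Sum>j\<in>J. A j * exp (\<mu> j * t)))) \<le> C / T"
proof (cases "J = {}")
  case True
  then show ?thesis by (intro exI[of _ 0]) auto
next
  case False
  define P where "P i c \<longleftrightarrow> c > 0 \<and> (\<forall>A t. t \<in> {0..1} \<longrightarrow>
    (\<exists>k\<in>{2..card J + 1}. \<bar>\<Sum>j\<in>J. A j * \<mu> j ^ k * exp (\<mu> j * t)\<bar> \<ge> c * \<bar>A i\<bar>))" for i c
  have "\<forall>i\<in>J. \<exists>c. P i c"
    unfolding P_def using exp_sum_some_derivative_large[OF assms] by blast
  then obtain cc where ccP: "\<And>i. i \<in> J \<Longrightarrow> P i (cc i)"
    using bchoice[of J P] by blast
  have cc: "cc i > 0"
    "t \<in> {0..1} \<Longrightarrow> \<exists>k\<in>{2..card J + 1}. \<bar>\<Sum>j\<in>J. A j * \<mu> j ^ k * exp (\<mu> j * t)\<bar> \<ge> cc i * \<bar>A i\<bar>"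
    if "i \<in> J" for i A t
    using ccP[OF that] unfolding P_def by blast+
  define c where "c = Min (cc ` J)"
  have c: "c > 0" "\<And>i. i \<in> J \<Longrightarrow> c \<le> cc i"
    using False assms(1) cc(1) by (auto simp: c_def)
  define B where "B = (\<Sum>j\<in>J. (1 + \<bar>\<mu> j\<bar>) ^ (card J + 2) * exp \<bar>\<mu> j\<bar>)"
  \<comment> \<open>On pieces of length \<open>1 / Q\<close> the derivative that is large at the left end stays large.\<close>
  obtain Q :: nat where Q: "real Q > max 1 (2 * B / c)" using reals_Archimedean2 by blast
  then have Qpos: "Q > 0" by (cases Q) auto
  have BQ: "B / Q \<le> c / 2"
    using Q Qpos c(1) by (simp add: field_simps)
  define \<kappa> where "\<kappa> = min 1 (c / 2)"
  have \<kappa>: "0 < \<kappa>" "\<kappa> \<le> 1" "\<kappa> \<le> c / 2" using c by (auto simp: \<kappa>_def)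
  define D where "D = 6 * 2 ^ card J / \<kappa>"
  have "norm (integral {a..b} (\<lambda>t. cis (\<Sum>j\<in>J. A j * exp (\<mu> j * t)))) \<le> Q * (D / T)"
    if "i \<in> J" and T: "T \<ge> 1" and Ai: "\<bar>A i\<bar> \<ge> T ^ (card J + 1)" and ab: "0 \<le> a" "a \<le> b" "b \<le> 1" for A a b T i
  proof -
    define \<phi> where "\<phi> k t = (\<Sum>j\<in>J. A j * \<mu> j ^ k * exp (\<mu> j * t))" for k t
    have deriv: "(\<phi> k has_real_derivative \<phi> (Suc k) t) (at t)" for k t
      unfolding \<phi>_def by (auto intro!: derivative_eq_intros sum.cong)
    \<comment> \<open>All derivatives are bounded above by multiples of the largest coefficient, so
      the lower bound must be a multiple of it too; therefore \<open>j1\<close> takes the place of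
      \<open>i\<close>.\<close>
    obtain j1 where j1: "j1 \<in> J" "\<And>j. j \<in> J \<Longrightarrow> \<bar>A j\<bar> \<le> \<bar>A j1\<bar>"
    proof -
      have "Max ((\<lambda>j. \<bar>A j\<bar>) ` J) \<in> (\<lambda>j. \<bar>A j\<bar>) ` J" using False assms(1) by (intro Max_in) auto
      then obtain j1 where "j1 \<in> J" "Max ((\<lambda>j. \<bar>A j\<bar>) ` J) = \<bar>A j1\<bar>" by auto
      then show ?thesis using that assms(1) by (metis Max_ge finite_imageI imageI)
    qed
    define M where "M = \<bar>A j1\<bar>"
    have MT: "M \<ge> T ^ (card J + 1)" using Ai j1 \<open>i \<in> J\<close> unfolding M_def by force
    have bound: "\<bar>\<phi> k t\<bar> \<le> B * M" if "k \<le> card J + 2" "t \<in> {0..1}" for k t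
    proof -
      have "\<bar>\<phi> k t\<bar> \<le> (\<Sum>j\<in>J. \<bar>A j * \<mu> j ^ k * exp (\<mu> j * t)\<bar>)"
        unfolding \<phi>_def by (rule sum_abs)
      also have "\<dots> \<le> (\<Sum>j\<in>J. M * (1 + \<bar>\<mu> j\<bar>) ^ (card J + 2) * exp \<bar>\<mu> j\<bar>)"
      proof (rule sum_mono)
        fix j assume j: "j \<in> J"
        have "\<bar>\<mu> j\<bar> ^ k \<le> (1 + \<bar>\<mu> j\<bar>) ^ k" by (intro power_mono) auto
        also have "\<dots> \<le> (1 + \<bar>\<mu> j\<bar>) ^ (card J + 2)" using that by (intro power_increasing) auto
        finally have 1: "\<bar>\<mu> j\<bar> ^ k \<le> (1 + \<bar>\<mu> j\<bar>) ^ (card J + 2)" .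
        have "\<mu> j * t \<le> \<bar>\<mu> j\<bar> * t" using that by (intro mult_right_mono) auto
        also have "\<dots> \<le> \<bar>\<mu> j\<bar> * 1" using that by (intro mult_left_mono) auto
        finally have 2: "exp (\<mu> j * t) \<le> exp \<bar>\<mu> j\<bar>" by simp
        show "\<bar>A j * \<mu> j ^ k * exp (\<mu> j * t)\<bar> \<le> M * (1 + \<bar>\<mu> j\<bar>) ^ (card J + 2) * exp \<bar>\<mu> j\<bar>"
          unfolding abs_mult power_abs abs_exp_cancel
          using 1 2 j1(2)[OF j] by (intro mult_mono) (auto simp: M_def)
      qed
      also have "\<dots> = B * M" by (simp add: B_def sum_distrib_left mult_ac)
      finally show ?thesis .
    qed
    have M0: "M \<ge> 0" by (simp add: M_def)
    define I where "I x y = integral {x..y} (\<lambda>t. cis (\<phi> 0 t))" for x y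
    have piece: "norm (I x y) \<le> D / T"
      if q: "q < Q" "real q / Q \<le> x" "x \<le> y" "y \<le> real (Suc q) / Q" for x y q
    proof -
      define t0 where "t0 = real q / Q"
      have t0: "t0 \<in> {0..1}" using q by (auto simp: t0_def)
      obtain k where k: "k \<in> {2..card J + 1}" "\<bar>\<phi> k t0\<bar> \<ge> cc j1 * M"
        using cc(2)[OF j1(1) t0, where A=A] unfolding \<phi>_def M_def by blast
      have kc: "\<bar>\<phi> k t0\<bar> \<ge> c * M"
        using k(2) mult_right_mono[OF c(2)[OF j1(1)] M0] by linarith
      have near: "\<bar>\<phi> k t - \<phi> k t0\<bar> \<le> c / 2 * M" if t: "t \<in> {x..y}" for t
      proof (cases "t = t0")
        case False
        have y1: "y \<le> 1" using q Qpos by (smt (verit) divide_le_eq_1_pos of_nat_0_less_iff of_nat_le_iff Suc_leI)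
        have tt: "t0 < t" "t - t0 \<le> 1 / Q" using q t False by (auto simp: t0_def add_divide_distrib)
        obtain z where z: "t0 < z" "z < t" "\<phi> k t - \<phi> k t0 = (t - t0) * \<phi> (Suc k) z"
          using MVT2[OF tt(1) deriv] by blast
        have "\<bar>\<phi> k t - \<phi> k t0\<bar> = (t - t0) * \<bar>\<phi> (Suc k) z\<bar>" using z tt by (simp add: abs_mult)
        also have "\<dots> \<le> 1 / Q * (B * M)"
          using tt z t0 t y1 k(1) by (intro mult_mono bound) auto
        also have "\<dots> \<le> c / 2 * M"
          using mult_right_mono[OF BQ M0] by simp
        finally show ?thesis .
      qed (use c M0 in auto)
      \<comment> \<open>Because \<open>\<kappa> \<le> 1\<close>, the power \<open>\<tau> ^ k\<close>
        is at most \<open>\<kappa> * T ^ (card J + 1)\<close>, which is half of the lower bound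
        \<open>c * M\<close> or less, whatever the order \<open>k\<close>. The other half absorbs
        the variation over the piece.\<close>
      define \<tau> where "\<tau> = \<kappa> * T"
      have \<tau>: "\<tau> > 0" using \<kappa> T by (simp add: \<tau>_def)
      have "\<tau> ^ k = \<kappa> ^ k * T ^ k" by (simp add: \<tau>_def power_mult_distrib)
      also have "\<dots> \<le> \<kappa> * T ^ (card J + 1)"
        using k(1) \<kappa> T power_decreasing[of 1 k \<kappa>] by (intro mult_mono power_increasing) auto
      also have "\<dots> \<le> c / 2 * M"
        using \<kappa> MT c T by (intro mult_mono) auto
      finally have \<tau>k: "\<tau> ^ k \<le> c / 2 * M" .
      obtain k' where k': "k = Suc k'" "k' \<noteq> 0" "k' \<le> card J" using k(1) by (cases k) auto
      have "norm (I x y) \<le> (6 * 2 ^ k' - 2) / \<tau>"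
      proof (cases "\<phi> k t0 \<ge> 0")
        case True
        show ?thesis unfolding I_def
        proof (rule van_der_corput[of \<phi>, OF deriv \<tau> q(3)])
          fix t assume "t \<in> {x..y}"
          from near[OF this] show "\<tau> ^ Suc k' \<le> \<phi> (Suc k') t"
            using kc True \<tau>k unfolding k'(1) by linarith
        qed (use k' in auto)
      next
        case False
        have "norm (integral {x..y} (\<lambda>t. cis (- \<phi> 0 t))) \<le> (6 * 2 ^ k' - 2) / \<tau>"
        proof (rule van_der_corput[of "\<lambda>k t. - \<phi> k t", OF _ \<tau> q(3)])
          fix t assume "t \<in> {x..y}"
          from near[OF this] show "\<tau> ^ Suc k' \<le> - \<phi> (Suc k') t"
            using kc False \<tau>k unfolding k'(1) by linarith
        qed (use k' in \<open>auto intro!: derivative_eq_intros deriv\<close>)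
        also have "integral {x..y} (\<lambda>t. cis (- \<phi> 0 t)) = cnj (I x y)"
          by (simp add: I_def integral_cnj cis_cnj)
        finally show ?thesis by simp
      qed
      also have "\<dots> \<le> 6 * 2 ^ card J / \<tau>"
        using \<tau> power_increasing[OF k'(3), of "2::real"] by (intro divide_right_mono) linarith+
      also have "\<dots> = D / T" by (simp add: D_def \<tau>_def)
      finally show ?thesis .
    qed
    have int: "(\<lambda>t. cis (\<phi> 0 t)) integrable_on {x..y}" for x y
    proof (rule integrable_continuous_real)
      have "continuous_on {x..y} (\<phi> 0)"
        by (rule DERIV_continuous_on) (rule has_field_derivative_at_within[OF deriv])
      then show "continuous_on {x..y} (\<lambda>t. cis (\<phi> 0 t))"
        unfolding cis_conv_exp by (intro continuous_intros)
    qed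
    have DT: "D / T \<ge> 0" using \<kappa> T by (simp add: D_def)
    have "norm (I x y) \<le> n * (D / T)"
      if "n \<le> Q" "0 \<le> x" "x \<le> y" "y \<le> real n / Q" for n x y
      using that
    proof (induction n arbitrary: x y)
      case 0
      then have "x = y" by simp
      then show ?case by (simp add: I_def)
    next
      case (Suc n)
      consider "y \<le> real n / Q" | "real n / Q \<le> x" | "x < real n / Q" "real n / Q < y" by linarith
      then show ?case
      proof cases
        case 1
        then have "norm (I x y) \<le> n * (D / T)" using Suc.IH[of x y] Suc.prems by simp
        also have "\<dots> \<le> real (Suc n) * (D / T)" using DT by (intro mult_right_mono) auto
        finally show ?thesis .
      next
        case 2
        then have "norm (I x y) \<le> D / T" using Suc.prems by (intro piece[of n]) auto
        also have "\<dots> \<le> real (Suc n) * (D / T)" using mult_right_mono[OF _ DT, of 1 "real (Suc n)"] by simp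
        finally show ?thesis .
      next
        case 3
        have "norm (I x (real n / Q)) \<le> n * (D / T)" using Suc.IH[of x "real n / Q"] Suc.prems 3 by simp
        moreover have "norm (I (real n / Q) y) \<le> D / T" using Suc.prems 3 by (intro piece[of n]) auto
        moreover have eq: "I x y = I x (real n / Q) + I (real n / Q) y"
          unfolding I_def using 3 by (intro Henstock_Kurzweil_Integration.integral_combine[symmetric] int) auto
        ultimately show ?thesis
          using norm_triangle_ineq[of "I x (real n / Q)" "I (real n / Q) y"]
          unfolding of_nat_Suc distrib_right eq by linarith
      qed
    qed
    from this[of Q a b] show ?thesis
      using ab Qpos by (simp add: I_def \<phi>_def)
  qed
  then show ?thesis
    using \<kappa> by (intro exI[of _ "Q * D"]) (auto simp: D_def)
qed

section \<open>Trigonometric polynomials detecting digits\<close>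

definition ee :: "real \<Rightarrow> complex" where
  "ee x = cis (2 * pi * x)"

lemma ee_0 [simp]: "ee 0 = 1"
  by (simp add: ee_def)

lemma ee_add: "ee (x + y) = ee x * ee y"
  by (simp add: ee_def cis_mult distrib_left)

lemma norm_ee [simp]: "norm (ee x) = 1"
  by (simp add: ee_def)

lemma ee_of_int [simp]: "ee (of_int n) = 1"
  by (simp add: ee_def)

lemma ee_cnj: "cnj (ee x) = ee (- x)"
  by (simp add: ee_def cis_cnj)

lemma ee_diff: "ee (x - y) = ee x * cnj (ee y)"
  by (simp add: ee_cnj flip: ee_add)

lemma ee_of_nat_mult: "ee (real n * x) = ee x ^ n"
  unfolding ee_def Complex.DeMoivre by (simp add: mult_ac)

lemma ee_add_of_int: "ee (x + of_int n) = ee x"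
  by (simp add: ee_add)

lemma ee_sum: "finite I \<Longrightarrow> ee (\<Sum>i\<in>I. f i) = (\<Prod>i\<in>I. ee (f i))"
  by (induction I rule: finite_induct) (auto simp: ee_add)

lemma ee_eq_1_iff: "ee x = 1 \<longleftrightarrow> x \<in> \<int>"
proof
  assume "ee x = 1"
  then have "cos (2 * pi * x) = 1" by (auto simp: ee_def complex_eq_iff)
  then obtain n :: int where "2 * pi * x = of_int n * (2 * pi)" by (auto simp: cos_one_2pi_int)
  then have "x = of_int n" by simp
  then show "x \<in> \<int>" by simp
next
  assume "x \<in> \<int>"
  then show "ee x = 1" by (auto elim: Ints_cases)
qed

lemma norm_ee_diff_le: "norm (ee x - ee y) \<le> 2 * pi * \<bar>x - y\<bar>"
proof -
  have "ee x - ee y = ee y * (ee (x - y) - 1)"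
    by (simp add: algebra_simps flip: ee_add)
  then have "norm (ee x - ee y) = norm (ee (x - y) - 1)"
    by (simp add: norm_mult)
  also have "\<dots> = 2 * \<bar>sin (pi * (x - y))\<bar>"
    unfolding ee_def cis_conv_exp dist_exp_i_1 by (simp add: mult.assoc)
  also have "\<dots> \<le> 2 * \<bar>pi * (x - y)\<bar>"
    by (intro mult_left_mono abs_sin_x_le_abs_x) auto
  finally show ?thesis by (simp add: abs_mult)
qed

text \<open>Expanding the square modulus of a geometric sum gives a Fejer kernel up to scaling. Read
  from left to right this shows that a kernel is nonnegative; read backwards it opens mean
  squares.\<close>

lemma sum_ee_pairs:
  "(\<Sum>z\<in>{..<M} \<times> {..<M}. ee (of_int (int (fst z) - int (snd z)) * y))
     = of_real ((norm (\<Sum>t<M. ee (real t * y)))\<^sup>2)"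
proof -
  have "of_real ((norm (\<Sum>t<M. ee (real t * y)))\<^sup>2)
      = (\<Sum>t<M. ee (real t * y)) * (\<Sum>t<M. cnj (ee (real t * y)))"
    by (simp only: complex_norm_square cnj_sum)
  also have "\<dots> = (\<Sum>z\<in>{..<M} \<times> {..<M}. ee (real (fst z) * y) * cnj (ee (real (snd z) * y)))"
    by (simp add: sum_product sum.cartesian_product case_prod_beta)
  also have "\<dots> = (\<Sum>z\<in>{..<M} \<times> {..<M}. ee (of_int (int (fst z) - int (snd z)) * y))"
    by (intro sum.cong) (simp_all add: left_diff_distrib ee_diff)
  finally show ?thesis by simp
qed

lemma sum_ee_root_of_unity:
  assumes "M > 0" "\<not> int M dvd k"
  shows "(\<Sum>t<M * n. ee (real t * (of_int k / real M))) = 0"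
proof -
  have "of_int k / real M \<notin> \<int>"
  proof
    assume "of_int k / real M \<in> \<int>"
    then obtain l where "of_int k / real M = of_int l" by (auto elim: Ints_cases)
    then have "real_of_int k = real_of_int (int M * l)" using assms(1) by (simp add: field_simps)
    then have "k = int M * l" by linarith
    then show False using assms(2) by simp
  qed
  then have ne: "ee (of_int k / real M) \<noteq> 1" by (simp add: ee_eq_1_iff)
  have "ee (real (M * n) * (of_int k / real M)) = ee (of_int (int n * k))"
    using assms(1) by (intro arg_cong[of _ _ ee]) simp
  then have "ee (of_int k / real M) ^ (M * n) = 1"
    by (simp only: ee_of_nat_mult ee_of_int)
  then show ?thesis
    unfolding ee_of_nat_mult using geometric_sum[OF ne, of "M * n"] by simp
qed

text \<open>Parseval on the cyclic group of order \<open>M\<close> for the indicator of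
  \<open>n\<close> consecutive points: two distinct points differ by less than \<open>M\<close>, so
  only the diagonal survives. The free shift \<open>s\<close> lets it be applied to each row of a
  sum over pairs.\<close>

lemma sum_norm_square_dft:
  fixes s :: int
  assumes "n \<le> M" "M > 0"
  shows "(\<Sum>t<M. (norm (\<Sum>a<n. ee (real a * (of_int (int t - s) / real M))))\<^sup>2) = real M * real n"
proof -
  have "complex_of_real (\<Sum>t<M. (norm (\<Sum>a<n. ee (real a * (of_int (int t - s) / real M))))\<^sup>2)
      = (\<Sum>t<M. \<Sum>z\<in>{..<n} \<times> {..<n}. ee (of_int (int (fst z) - int (snd z)) * (of_int (int t - s) / real M)))"
    by (simp only: sum_ee_pairs of_real_sum)
  also have "\<dots> = (\<Sum>z\<in>{..<n} \<times> {..<n}. \<Sum>t<M. ee (of_int (int (fst z) - int (snd z)) * (of_int (int t - s) / real M)))"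
    by (rule sum.swap)
  also have "\<dots> = (\<Sum>z\<in>{..<n} \<times> {..<n}. if fst z = snd z then of_nat M else 0)"
  proof (rule sum.cong[OF refl])
    fix z assume z: "z \<in> {..<n} \<times> {..<n}"
    define k where "k = int (fst z) - int (snd z)"
    have "(\<Sum>t<M. ee (of_int k * (of_int (int t - s) / real M)))
        = ee (- of_int (k * s) / real M) * (\<Sum>t<M * 1. ee (real t * (of_int k / real M)))"
      unfolding sum_distrib_left by (simp add: algebra_simps diff_divide_distrib flip: ee_add)
    also have "\<dots> = (if fst z = snd z then of_nat M else 0)"
    proof (cases "fst z = snd z")
      case True
      then show ?thesis by (simp add: k_def)
    next
      case False
      then have "k \<noteq> 0" "\<bar>k\<bar> < int M" using z assms(1) by (auto simp: k_def)
      then have "\<not> int M dvd k" by (metis abs_of_nat dvd_imp_le_int not_le)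
      then have "(\<Sum>t<M * 1. ee (real t * (of_int k / real M))) = 0"
        using assms(2) by (rule sum_ee_root_of_unity[rotated])
      then show ?thesis using False by simp
    qed
    finally show "(\<Sum>t<M. ee (of_int (int (fst z) - int (snd z)) * (of_int (int t - s) / real M)))
       = (if fst z = snd z then of_nat M else 0)"
      by (simp add: k_def)
  qed
  also have "\<dots> = (\<Sum>a<n. \<Sum>b<n. if a = b then of_nat M else 0)"
    unfolding sum.cartesian_product by (rule sum.cong) auto
  also have "\<dots> = complex_of_real (real M * real n)"
    by simp
  finally show ?thesis by (simp only: of_real_eq_iff)
qed

lemma norm_sum_ee_le:
  assumes "ee y \<noteq> 1"
  shows "norm (\<Sum>t<M. ee (real t * y)) \<le> 2 / norm (ee y - 1)"
proof -
  have "(\<Sum>t<M. ee (real t * y)) = (ee y ^ M - 1) / (ee y - 1)"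
    using geometric_sum[OF assms, of M] by (simp add: ee_of_nat_mult)
  moreover have "norm (ee y ^ M - 1) \<le> 2"
    using norm_triangle_ineq4[of "ee y ^ M" 1] by (simp add: norm_power)
  ultimately show ?thesis by (simp add: norm_divide divide_right_mono)
qed

lemma norm_ee_minus_1_ge:
  assumes "0 < \<delta>" "\<delta> \<le> 1/2" "\<delta> \<le> frac y" "frac y \<le> 1 - \<delta>"
  shows "(norm (ee y - 1))\<^sup>2 \<ge> 2 - 2 * cos (2 * pi * \<delta>)"
proof -
  define u where "u = frac y"
  have "ee y = ee (frac y + of_int \<lfloor>y\<rfloor>)" by (simp add: frac_def)
  then have "ee y = ee u" unfolding ee_add_of_int u_def .
  moreover have "(norm (ee u - 1))\<^sup>2 = 2 - 2 * cos (2 * pi * u)"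
  proof -
    have "(norm (ee u - 1))\<^sup>2 = (cos (2 * pi * u) - 1)\<^sup>2 + (sin (2 * pi * u))\<^sup>2"
      by (simp add: ee_def cmod_power2)
    also have "\<dots> = 2 - 2 * cos (2 * pi * u)"
      using sin_cos_squared_add[of "2 * pi * u"] by (simp add: power2_eq_square algebra_simps)
    finally show ?thesis .
  qed
  moreover have "cos (2 * pi * u) \<le> cos (2 * pi * \<delta>)"
  proof (cases "u \<le> 1/2")
    case True
    then show ?thesis using assms by (intro cos_monotone_0_pi_le) (auto simp: u_def)
  next
    case False
    have "cos (2 * pi * u) = cos (2 * pi * (1 - u))"
      using cos_minus[of "2 * pi * u"] cos_periodic[of "- (2 * pi * u)"] by (simp add: algebra_simps)
    also have "\<dots> \<le> cos (2 * pi * \<delta>)"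
      using assms False by (intro cos_monotone_0_pi_le) (auto simp: u_def)
    finally show ?thesis .
  qed
  ultimately show ?thesis by simp
qed


section \<open>Test polynomials and the exponential sum criterion\<close>

text \<open>The threshold for \<open>frac x\<close> is the condition that the first digit be at most
  \<open>p div 3\<close>. The allowed interval fills a fixed proportion of the circle for all
  \<open>p \<ge> 3\<close>, which bounds the coefficient sum independently of \<open>p\<close>.
  Independence of \<open>\<eta>\<close> is essential as well:
  \<open>exponential_sum_criterion\<close> takes \<open>\<eta>\<close> exponentially small in the
  number of digits, which only raises the degree.\<close>

lemma test_polynomial_exists:
  fixes p :: nat and \<eta> :: real
  assumes "p \<ge> 3" "\<eta> > 0"
  shows "\<exists>F c. finite F \<and> 0 \<in> F \<and> c 0 = 1 \<and> (\<forall>m\<in>F. int p dvd m \<longrightarrow> m \<noteq> 0 \<longrightarrow> c m = 0) \<and>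
    (\<Sum>m\<in>F. norm (c m)) \<le> 15 \<and>
    (\<forall>x. \<exists>P\<ge>0. (\<Sum>m\<in>F. c m * ee (of_int m * x)) = of_real P \<and>
       (frac x \<ge> real (p div 3 + 1) / real p \<longrightarrow> P \<le> \<eta>))"
proof -
  \<comment> \<open>\<open>2 * K / p\<close> fits into the allowed interval, while rounding still
    leaves \<open>p \<le> 10 * K\<close>. The coefficient sum will be at most
    \<open>3 * p / (2 * K)\<close>, whence the constant 15.\<close>
  define K where "K = (p div 3 + 1) div 2"
  have "3 * (p div 3) \<le> p" "p < 3 * (p div 3) + 3" "2 * K \<le> p div 3 + 1" "p div 3 + 1 < 2 * K + 2"
    unfolding K_def by linarith+
  moreover from this have "K \<ge> 1" using assms(1) by linarith
  ultimately have K: "K \<ge> 1" "2 * K \<le> p div 3 + 1" "p \<le> 10 * K" "K < p"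
    by linarith+
  \<comment> \<open>As \<open>8 * \<delta> = 2 * K / p\<close>, the interval from 0 to
    \<open>8 * \<delta>\<close> is allowed. The centres of the kernels will lie between
    \<open>\<delta>\<close> and \<open>7 * \<delta>\<close>, which leaves the margin
    \<open>\<delta>\<close> on both sides.\<close>
  define \<delta> where "\<delta> = real K / (4 * real p)"
  have \<delta>: "0 < \<delta>" "\<delta> < 1 / 2" using K by (auto simp: \<delta>_def)
  define s where "s = 2 - 2 * cos (2 * pi * \<delta>)"
  have "s > 0"
    using cos_monotone_0_pi[of 0 "2 * pi * \<delta>"] \<delta> by (simp add: s_def)
  obtain L0 :: nat where L0: "real L0 > 4 / (s * \<eta>)" using reals_Archimedean2 by blast
  \<comment> \<open>Large enough for the kernels to be below \<open>\<eta>\<close> at distance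
    \<open>\<delta>\<close> from their centres, and even so that \<open>a\<close> is exactly
    \<open>2 * b\<close>.\<close>
  define L where "L = 2 * Suc L0"
  have L: "L > 0" by (simp add: L_def)
  define M where "M = p * L"
  define a where "a = K * L"
  define b where "b = K * Suc L0"
  have M0: "M > 0" "a > 0" "b > 0" using assms K by (auto simp: M_def L_def a_def b_def)
  have "a \<le> M"
    using K(4) unfolding a_def M_def by (intro mult_le_mono) auto
  moreover have "a = 2 * b"
    by (simp add: a_def b_def L_def)
  ultimately have ab: "a \<le> M" "b \<le> M" "a = 2 * b" by auto
  have M_large: "real M > 4 / (s * \<eta>)"
  proof -
    have "1 * L \<le> M" unfolding M_def using assms(1) by (intro mult_le_mono) auto
    then show ?thesis using L0 unfolding L_def by simp
  qed
  define Z where "Z = {..<M} \<times> {..<M}"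
  define d where "d z = int (fst z) - int (snd z)" for z :: "nat \<times> nat"
  \<comment> \<open>The polynomial is the average over \<open>i < a\<close>, \<open>j < b\<close> of Fejer kernels centred at \<open>\<delta> + (i + j) / M\<close>.
    The average over \<open>i\<close> kills the multiples of \<open>p\<close>, and having two averages makes the coefficients
    absolutely summable by Parseval.\<close>
  define F where "F = {- int M..int M}"
  define A where "A n m = (\<Sum>i<n. ee (real i * (of_int m / real M)))" for n m
  define w where "w m = ee (- of_int m * \<delta>) * A a (- m) * A b (- m) / (of_nat a * of_nat b)" for m
  define c where "c m = (\<Sum>z\<in>{z\<in>Z. d z = m}. w m / of_nat M)" for m
  have Z: "finite Z" "d ` Z \<subseteq> F" "finite F" by (auto simp: Z_def d_def F_def)
  have "c 0 = 1"
  proof -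
    have "w 0 = 1" using M0 by (simp add: w_def A_def)
    have "{z\<in>Z. d z = 0} = (\<lambda>t. (t, t)) ` {..<M}" by (auto simp: Z_def d_def)
    then have "card {z\<in>Z. d z = 0} = M" by (simp add: card_image inj_on_def)
    then show ?thesis using \<open>w 0 = 1\<close> M0 by (simp add: c_def)
  qed
  moreover have "c m = 0" if m: "m \<in> F" "int p dvd m" "m \<noteq> 0" for m
  proof -
    obtain m' where m': "m = int p * m'" using m by blast
    \<comment> \<open>For \<open>m\<close> a multiple of \<open>p\<close> the ratio of the geometric
      sum \<open>A a (- m)\<close> is an \<open>L\<close>-th root of unity, and its
      \<open>a = K * L\<close> terms run through \<open>K\<close> full periods. The ratio is 1 only
      if \<open>M\<close> divides \<open>m\<close>, but differences of indices below
      \<open>M\<close> reach no such \<open>m\<close> except 0.\<close>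
    consider "int L dvd m'" | "\<not> int L dvd m'" by blast
    then show ?thesis
    proof cases
      case 1
      then have "int M dvd m" by (auto simp: M_def m')
      then have "\<bar>m\<bar> \<ge> int M" using \<open>m \<noteq> 0\<close> by (metis abs_of_nat dvd_imp_le_int)
      then have "{z\<in>Z. d z = m} = {}" by (auto simp: Z_def d_def)
      then show ?thesis by (simp only: c_def sum.empty)
    next
      case 2
      have "(\<Sum>t<L * K. ee (real t * (of_int (- m') / real L))) = 0"
        using 2 by (intro sum_ee_root_of_unity) (auto simp: L_def)
      moreover have "of_int (- m) / real M = of_int (- m') / real L"
        using assms by (simp add: m' M_def)
      ultimately have "A a (- m) = 0" by (simp only: A_def a_def mult.commute[of K])
      then show ?thesis by (simp add: c_def w_def)
    qed
  qed
  moreover have "(\<Sum>m\<in>F. norm (c m)) \<le> 15"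
  proof -
    define B where "B n t t' = (norm (\<Sum>i<n. ee (real i * (of_int (int t - int t') / real M))))\<^sup>2" for n t t'
    \<comment> \<open>AM-GM separates the two averages. Writing the sum over \<open>m\<close> as a
      sum over pairs \<open>z\<close> makes \<open>t\<close> run through a full period for each
      \<open>t'\<close>, so Parseval applies to both; with \<open>a = 2 * b\<close> the total is
      \<open>3 * M / (2 * a)\<close>.\<close>
    have w: "norm (w (d z)) \<le> (B a (snd z) (fst z) + B b (snd z) (fst z)) / (2 * (real a * real b))" for z
    proof -
      define u where "u = norm (A a (- d z))"
      define v where "v = norm (A b (- d z))"
      have "u * v \<le> (u\<^sup>2 + v\<^sup>2) / 2"
        using sum_squares_bound[of u v] by simp
      then have "u * v / (real a * real b) \<le> (u\<^sup>2 + v\<^sup>2) / 2 / (real a * real b)"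
        by (intro divide_right_mono) auto
      then show ?thesis
        by (simp add: w_def u_def v_def norm_mult norm_divide B_def A_def d_def)
    qed
    have sumB: "(\<Sum>t<M. B n t t') = real M * real n" if "n \<le> M" for n t'
      unfolding B_def using sum_norm_square_dft[OF that M0(1)] .
    have "(\<Sum>m\<in>F. norm (c m)) \<le> (\<Sum>m\<in>F. \<Sum>z\<in>{z\<in>Z. d z = m}. norm (w (d z)) / real M)"
    proof (rule sum_mono)
      fix m
      have "norm (c m) \<le> (\<Sum>z\<in>{z\<in>Z. d z = m}. norm (w m / of_nat M))"
        unfolding c_def by (rule norm_sum)
      also have "\<dots> = (\<Sum>z\<in>{z\<in>Z. d z = m}. norm (w (d z)) / real M)"
        by (intro sum.cong) (auto simp: norm_divide)
      finally show "norm (c m) \<le> (\<Sum>z\<in>{z\<in>Z. d z = m}. norm (w (d z)) / real M)" .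
    qed
    also have "\<dots> = (\<Sum>z\<in>Z. norm (w (d z)) / real M)"
      by (rule sum.group) (use Z in auto)
    also have "\<dots> \<le> (\<Sum>z\<in>Z. (B a (snd z) (fst z) + B b (snd z) (fst z)) / (2 * (real a * real b)) / real M)"
      using w by (intro sum_mono divide_right_mono) auto
    also have "\<dots> = (\<Sum>t'<M. \<Sum>t<M. (B a t t' + B b t t') / (2 * (real a * real b)) / real M)"
      unfolding Z_def by (simp add: sum.cartesian_product case_prod_beta)
    also have "\<dots> = (\<Sum>t'<M. (\<Sum>t<M. B a t t') + (\<Sum>t<M. B b t t')) / (2 * (real a * real b)) / real M"
      by (simp only: sum.distrib flip: sum_divide_distrib)
    also have "\<dots> = (real M * (real M * a + real M * b)) / (2 * (real a * real b)) / real M"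
      using ab by (simp only: sumB sum_constant card_lessThan)
    also have "\<dots> = 3 * real M / (2 * real a)"
      using M0 ab(3) by (simp add: field_simps)
    also have "\<dots> = 3 * real p / (2 * real K)"
      using L K by (simp add: M_def a_def field_simps)
    also have "\<dots> \<le> 15" using K by (simp add: field_simps)
    finally show ?thesis .
  qed
  moreover have "\<exists>P\<ge>0. (\<Sum>m\<in>F. c m * ee (of_int m * x)) = of_real P \<and>
       (frac x \<ge> real (p div 3 + 1) / real p \<longrightarrow> P \<le> \<eta>)" for x
  proof -
    define y where "y i j = x - \<delta> - (real i + real j) / real M" for i j :: nat
    define S where "S i j = (norm (\<Sum>t<M. ee (real t * y i j)))\<^sup>2" for i j
    define P where "P = (\<Sum>i<a. \<Sum>j<b. S i j) / (real a * real b * real M)"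
    have "(\<Sum>m\<in>F. c m * ee (of_int m * x)) = (\<Sum>m\<in>F. \<Sum>z\<in>{z\<in>Z. d z = m}. w (d z) / of_nat M * ee (of_int (d z) * x))"
      unfolding c_def sum_distrib_right by (intro sum.cong) auto
    also have "\<dots> = (\<Sum>z\<in>Z. w (d z) / of_nat M * ee (of_int (d z) * x))"
      by (rule sum.group) (use Z in auto)
    also have "\<dots> = (\<Sum>z\<in>Z. (\<Sum>i<a. \<Sum>j<b. ee (of_int (d z) * y i j)) / of_real (real a * real b * real M))"
    proof (rule sum.cong[OF refl])
      fix z
      define m where "m = d z"
      have "ee (of_int m * y i j) = ee (- of_int m * \<delta>) * ee (of_int m * x) *
          (ee (real i * (of_int (- m) / real M)) * ee (real j * (of_int (- m) / real M)))" for i j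
        by (simp add: y_def algebra_simps add_divide_distrib flip: ee_add)
      then have "(\<Sum>i<a. \<Sum>j<b. ee (of_int m * y i j)) =
         ee (- of_int m * \<delta>) * ee (of_int m * x) * (A a (- m) * A b (- m))"
        unfolding A_def sum_product by (simp only: sum_distrib_left)
      then show "w (d z) / of_nat M * ee (of_int (d z) * x) =
          (\<Sum>i<a. \<Sum>j<b. ee (of_int (d z) * y i j)) / of_real (real a * real b * real M)"
        by (simp add: w_def m_def)
    qed
    also have "\<dots> = (\<Sum>i<a. \<Sum>j<b. \<Sum>z\<in>Z. ee (of_int (d z) * y i j)) / of_real (real a * real b * real M)"
      unfolding sum_divide_distrib[symmetric]
      by (subst sum.swap, subst (2) sum.swap) (rule refl)
    also have "\<dots> = of_real P"
      unfolding P_def Z_def d_def sum_ee_pairs S_def by simp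
    finally have eq: "(\<Sum>m\<in>F. c m * ee (of_int m * x)) = of_real P" .
    have "P \<ge> 0" unfolding P_def S_def by (intro divide_nonneg_nonneg sum_nonneg) auto
    moreover have "P \<le> \<eta>" if x: "frac x \<ge> real (p div 3 + 1) / real p"
    proof -
      have S: "S i j \<le> \<eta> * real M" if ij: "i < a" "j < b" for i j
      proof -
        define v where "v = \<delta> + (real i + real j) / real M"
        have Kp: "real K / real p = 4 * \<delta>" by (simp add: \<delta>_def)
        have "real a / real M = real K / real p" using L by (simp add: a_def M_def)
        then have aM: "real a / real M = 4 * \<delta>" "real b / real M = 2 * \<delta>"
          unfolding Kp using ab(3) by auto
        have "real i / real M \<le> real a / real M" "real j / real M \<le> real b / real M"
          using ij by (auto intro!: divide_right_mono)
        then have v: "\<delta> \<le> v" "v \<le> 7 * \<delta>"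
          unfolding v_def aM add_divide_distrib by auto
        have "real (2 * K) / real p \<le> real (p div 3 + 1) / real p"
          by (intro divide_right_mono) (use K in linarith, simp)
        then have "8 * \<delta> \<le> frac x" using x Kp by simp
        then have fr: "\<delta> \<le> frac x - v" "frac x - v \<le> 1 - \<delta>"
          using v frac_lt_1[of x] by linarith+
        have "frac (y i j) = frac x - v"
        proof (subst frac_unique_iff, intro conjI)
          show "y i j - (frac x - v) \<in> \<int>" by (simp add: y_def v_def frac_def)
        qed (use fr \<delta> in auto)
        then have n: "(norm (ee (y i j) - 1))\<^sup>2 \<ge> s"
          unfolding s_def using fr \<delta> by (intro norm_ee_minus_1_ge) auto
        then have "ee (y i j) \<noteq> 1" using \<open>s > 0\<close> by auto
        from norm_sum_ee_le[OF this] have "S i j \<le> (2 / norm (ee (y i j) - 1))\<^sup>2"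
          unfolding S_def by (intro power_mono) auto
        also have "\<dots> \<le> 4 / s"
          using n \<open>s > 0\<close> by (simp add: power_divide frac_le)
        also have "\<dots> \<le> \<eta> * real M"
          using M_large \<open>s > 0\<close> assms(2) by (simp add: field_simps)
        finally show ?thesis .
      qed
      have "(\<Sum>i<a. \<Sum>j<b. S i j) \<le> (\<Sum>i<a. \<Sum>j<b. \<eta> * real M)"
        using S by (intro sum_mono) auto
      then show ?thesis
        using M0 by (simp add: P_def field_simps)
    qed
    ultimately show ?thesis using eq by blast
  qed
  ultimately show ?thesis
    using Z(3) by (intro exI[of _ F] exI[of _ c]) (auto simp: F_def)
qed

section \<open>Reading digits from fractional parts\<close>

lemma frac_digit: "frac (real p * y) = real p * frac y - of_int \<lfloor>real p * frac y\<rfloor>"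
proof -
  have "real p * y = real p * frac y + of_int (int p * \<lfloor>y\<rfloor>)"
    by (simp add: frac_def algebra_simps)
  then have "frac (real p * y) = frac (real p * frac y + of_int (int p * \<lfloor>y\<rfloor>))"
    by (simp only:)
  also have "\<dots> = frac (real p * frac y)"
    unfolding frac_def[of "_ + _"] by (simp only: floor_add_int[symmetric]) (simp add: frac_def)
  finally show ?thesis by (simp add: frac_def)
qed

text \<open>Digit \<open>k\<close>, counted from 1, is the floor of
  \<open>p * frac (p ^ (k - 1) * x)\<close>, so each hypothesis bounds one digit by
  \<open>p div 3\<close>. What is left after \<open>H\<close> digits is a fractional part divided by
  \<open>p ^ H\<close>, which explains the half-open interval in \<open>U\<close>.\<close>

lemma frac_in_U:
  assumes "p > 0" and digits: "\<And>k. k < H \<Longrightarrow> frac (real p ^ k * x) < real (p div 3 + 1) / real p"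
  shows "frac x \<in> U p H"
proof -
  define d where "d k = \<lfloor>real p * frac (real p ^ (k - 1) * x)\<rfloor>" for k
  have expand: "frac x = (\<Sum>k=1..n. real_of_int (d k) / real p ^ k) + frac (real p ^ n * x) / real p ^ n" for n
  proof (induction n)
    case (Suc n)
    have "frac (real p ^ Suc n * x) = real p * frac (real p ^ n * x) - real_of_int (d (Suc n))"
      using frac_digit[of p "real p ^ n * x"] by (simp add: d_def mult.assoc)
    then have "real_of_int (d (Suc n)) / real p ^ Suc n + frac (real p ^ Suc n * x) / real p ^ Suc n
        = frac (real p ^ n * x) / real p ^ n"
      using assms(1) by (simp add: field_simps)
    then show ?case using Suc by simp
  qed simp
  have "0 \<le> d k \<and> real_of_int (d k) \<le> real p / 3" if "k \<in> {1..H}" for k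
  proof -
    have "real p * frac (real p ^ (k - 1) * x) < real (p div 3 + 1)"
      using digits[of "k - 1"] that assms(1) by (auto simp: field_simps)
    then have "d k \<le> int (p div 3)" unfolding d_def by linarith
    moreover have "0 \<le> d k" unfolding d_def by simp
    ultimately show ?thesis by linarith
  qed
  moreover have "frac (real p ^ H * x) / real p ^ H \<in> {0..<1 / real p ^ H}"
    using assms(1) frac_lt_1[of "real p ^ H * x"] by (simp add: divide_strict_right_mono)
  ultimately show ?thesis
    unfolding U_def set_plus_def using expand[of H] by blast
qed

text \<open>Modulo \<open>p\<close> the lowest coefficient is divisible by \<open>p\<close>, hence
  0; dividing the relation by \<open>p\<close> shifts the others down.\<close>

lemma digit_sum_eq_0:
  fixes g :: "nat \<Rightarrow> int" and p :: int
  assumes "p \<noteq> 0" "(\<Sum>k<H. g k * p ^ k) = 0" and "\<And>k. k < H \<Longrightarrow> p dvd g k \<Longrightarrow> g k = 0"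
  shows "\<forall>k<H. g k = 0"
  using assms(2,3)
proof (induction H arbitrary: g)
  case (Suc H)
  have eq: "(\<Sum>k<Suc H. g k * p ^ k) = g 0 + p * (\<Sum>k<H. g (Suc k) * p ^ k)"
    unfolding sum.lessThan_Suc_shift sum_distrib_left by (simp add: mult_ac)
  then have "g 0 = p * - (\<Sum>k<H. g (Suc k) * p ^ k)" using Suc.prems(1) by simp
  then have g0: "g 0 = 0" using Suc.prems(2)[of 0] by (metis dvd_triv_left zero_less_Suc)
  then have "(\<Sum>k<H. g (Suc k) * p ^ k) = 0" using eq Suc.prems(1) \<open>p \<noteq> 0\<close> by simp
  then have "\<forall>k<H. g (Suc k) = 0" using Suc.prems(2) by (intro Suc.IH) auto
  then show ?case using g0 by (metis less_Suc_eq_0_disj)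
qed simp

definition is_test_polynomial :: "nat \<Rightarrow> real \<Rightarrow> int set \<Rightarrow> (int \<Rightarrow> complex) \<Rightarrow> bool" where
  "is_test_polynomial p \<eta> F c \<longleftrightarrow> finite F \<and> 0 \<in> F \<and> c 0 = 1 \<and>
    (\<forall>m\<in>F. int p dvd m \<longrightarrow> m \<noteq> 0 \<longrightarrow> c m = 0) \<and> (\<Sum>m\<in>F. norm (c m)) \<le> 15 \<and>
    (\<forall>x. \<exists>P\<ge>0. (\<Sum>m\<in>F. c m * ee (of_int m * x)) = of_real P \<and>
       (frac x \<ge> real (p div 3 + 1) / real p \<longrightarrow> P \<le> \<eta>))"

text \<open>\<open>g\<close> selects a frequency for every prime and digit position, and
  \<open>N g j\<close> is the resulting total frequency of \<open>\<alpha> j\<close>. The data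
  \<open>G\<close>, \<open>W\<close> and \<open>N\<close> are fixed before \<open>S\<close>,
  \<open>\<alpha>\<close> and \<open>\<beta>\<close>, so finitely many exponential sums decide about
  all shifts at once.\<close>

lemma exponential_sum_criterion:
  fixes J :: "nat set" and p :: "nat \<Rightarrow> nat" and H :: nat
  assumes "finite J" "J \<noteq> {}" "H \<ge> 1" and p3: "\<And>j. j \<in> J \<Longrightarrow> p j \<ge> 3"
  shows "\<exists>G W (N :: (nat \<times> nat \<Rightarrow> int) \<Rightarrow> nat \<Rightarrow> int). finite G \<and> (\<forall>g. W g \<ge> 0) \<and> (\<Sum>g\<in>G. W g) \<le> 15 ^ (card J * H) \<and>
    (\<forall>g\<in>G. \<exists>j\<in>J. N g j \<noteq> 0) \<and>
    (\<forall>S \<alpha> \<beta>. S \<ge> 1 \<longrightarrow>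
      (\<Sum>g\<in>G. W g * norm (\<Sum>s=1..S. ee (real s * (\<Sum>j\<in>J. of_int (N g j) * \<alpha> j)))) \<le> real S / 2 \<longrightarrow>
      (\<exists>s\<in>{1..S}. \<forall>j\<in>J. frac (real s * \<alpha> j + \<beta> j) \<in> U (p j) H))"
proof -
  define I where "I = J \<times> {..<H}"
  have I: "finite I" "card I = card J * H" "I \<noteq> {}" using assms by (auto simp: I_def lessThan_empty_iff)
  define n where "n = card I"
  have n: "n \<ge> 1" using I unfolding n_def by (metis One_nat_def Suc_leI card_gt_0_iff)
  \<comment> \<open>One forbidden digit contributes a factor at most \<open>\<eta>\<close>, all
    other factors are at most 15, so the product stays below 1/4.\<close>
  define \<eta> where "\<eta> = 1 / (4 * 15 ^ n :: real)"
  have "\<eta> > 0" by (simp add: \<eta>_def)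
  have "\<forall>j\<in>J. \<exists>Fc. is_test_polynomial (p j) \<eta> (fst Fc) (snd Fc)"
    unfolding is_test_polynomial_def using test_polynomial_exists[OF p3 \<open>\<eta> > 0\<close>] by simp
  then obtain Fc where Fc: "\<forall>j\<in>J. is_test_polynomial (p j) \<eta> (fst (Fc j)) (snd (Fc j))"
    using bchoice by meson
  define F where "F i = fst (Fc (fst i))" for i :: "nat \<times> nat"
  define c where "c i = snd (Fc (fst i))" for i :: "nat \<times> nat"
  have test: "is_test_polynomial (p (fst i)) \<eta> (F i) (c i)" if "i \<in> I" for i
    using Fc that by (auto simp: F_def c_def I_def)
  have F: "finite (F i)" "0 \<in> F i" "c i 0 = 1" "(\<Sum>m\<in>F i. norm (c i m)) \<le> 15" if "i \<in> I" for i
    using test[OF that] by (auto simp: is_test_polynomial_def)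
  define C where "C g = (\<Prod>i\<in>I. c i (g i))" for g
  define g0 where "g0 = restrict (\<lambda>_. 0 :: int) I"
  define X where "X = PiE I F"
  have X: "finite X" "g0 \<in> X" unfolding X_def g0_def using I F by (auto intro!: finite_PiE)
  \<comment> \<open>\<open>F\<close> may contain nonzero multiples of \<open>p\<close>, with
    coefficient 0. Dropping the choices with \<open>C g = 0\<close> removes them, as
    \<open>digit_sum_eq_0\<close> requires.\<close>
  define G where "G = {g\<in>X. C g \<noteq> 0} - {g0}"
  define N where "N g j = (\<Sum>k<H. g (j, k) * int (p j) ^ k)" for g j
  have C0: "C g0 = 1" unfolding C_def g0_def using F by (intro prod.neutral) auto
  have "finite G" using X by (simp add: G_def)
  moreover have "(\<Sum>g\<in>G. norm (C g)) \<le> 15 ^ (card J * H)"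
  proof -
    have "(\<Sum>g\<in>G. norm (C g)) \<le> (\<Sum>g\<in>X. norm (C g))"
      using X by (intro sum_mono2) (auto simp: G_def)
    also have "\<dots> = (\<Prod>i\<in>I. \<Sum>m\<in>F i. norm (c i m))"
      unfolding X_def C_def prod_norm[symmetric] using I F by (subst prod_sum_PiE) auto
    also have "\<dots> \<le> (\<Prod>i\<in>I. 15)"
      using F by (intro prod_mono) (auto intro!: sum_nonneg)
    finally show ?thesis using I by simp
  qed
  moreover have "\<exists>j\<in>J. N g j \<noteq> 0" if g: "g \<in> G" for g
  proof (rule ccontr)
    assume "\<not> ?thesis"
    then have zero: "N g j = 0" if "j \<in> J" for j using that by blast
    have "g i = 0" if i: "i \<in> I" for i
    proof -
      obtain j k where jk: "i = (j, k)" "j \<in> J" "k < H" using i by (auto simp: I_def)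
      have "\<forall>k<H. g (j, k) = 0"
      proof (rule digit_sum_eq_0)
        show "int (p j) \<noteq> 0" using p3[OF jk(2)] by simp
        show "(\<Sum>k<H. g (j, k) * int (p j) ^ k) = 0" using zero[OF jk(2)] by (simp add: N_def)
        fix l assume l: "l < H" "int (p j) dvd g (j, l)"
        have lI: "(j, l) \<in> I" using l jk by (simp add: I_def)
        have "C g \<noteq> 0" using g by (simp add: G_def)
        then have "c (j, l) (g (j, l)) \<noteq> 0" using lI I by (auto simp: C_def prod_zero_iff)
        moreover have "g (j, l) \<in> F (j, l)" using g lI by (auto simp: G_def X_def)
        ultimately show "g (j, l) = 0" using test[OF lI] l(2) by (auto simp: is_test_polynomial_def)
      qed
      then show ?thesis using jk by simp
    qed
    moreover have "g \<in> extensional I" using g by (auto simp: G_def X_def PiE_def)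
    ultimately have "g = g0" unfolding g0_def by (intro extensionalityI[of _ I]) auto
    then show False using g by (simp add: G_def)
  qed
  moreover have "\<exists>s\<in>{1..S}. \<forall>j\<in>J. frac (real s * \<alpha> j + \<beta> j) \<in> U (p j) H"
    if S: "S \<ge> 1" and small: "(\<Sum>g\<in>G. norm (C g) * norm (\<Sum>s=1..S. ee (real s * (\<Sum>j\<in>J. of_int (N g j) * \<alpha> j)))) \<le> real S / 2"
    for S :: nat and \<alpha> \<beta> :: "nat \<Rightarrow> real"
  proof (rule ccontr)
    assume none: "\<not> ?thesis"
    define y where "y s i = real (p (fst i)) ^ snd i * (real s * \<alpha> (fst i) + \<beta> (fst i))" for s :: nat and i :: "nat \<times> nat"
    define Q where "Q s i = (\<Sum>m\<in>F i. c i m * ee (of_int m * y s i))" for s i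
    define A where "A g = (\<Sum>j\<in>J. of_int (N g j) * \<alpha> j)" for g
    define B where "B g = (\<Sum>i\<in>I. of_int (g i) * real (p (fst i)) ^ snd i * \<beta> (fst i))" for g
    have Q15: "norm (Q s i) \<le> 15" if "i \<in> I" for s i
    proof -
      have "norm (Q s i) \<le> (\<Sum>m\<in>F i. norm (c i m))"
        unfolding Q_def by (rule sum_norm_le) (simp add: norm_mult)
      then show ?thesis using F[OF that] by simp
    qed
    have prod_small: "norm (\<Prod>i\<in>I. Q s i) \<le> 1 / 4" if s: "s \<in> {1..S}" for s
    proof -
      obtain j where j: "j \<in> J" "frac (real s * \<alpha> j + \<beta> j) \<notin> U (p j) H"
        using none s by blast
      then obtain k where k: "k < H" "frac (real (p j) ^ k * (real s * \<alpha> j + \<beta> j)) \<ge> real (p j div 3 + 1) / real (p j)"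
        using frac_in_U[of "p j" H] p3[OF j(1)] by (meson less_le_trans not_le zero_less_numeral)
      define i where "i = (j, k)"
      have i: "i \<in> I" using j k by (simp add: i_def I_def)
      have "\<exists>P\<ge>0. Q s i = of_real P \<and> (frac (y s i) \<ge> real (p j div 3 + 1) / real (p j) \<longrightarrow> P \<le> \<eta>)"
        using test[OF i] unfolding Q_def is_test_polynomial_def i_def by simp
      then have Qi: "norm (Q s i) \<le> \<eta>" using k(2) by (auto simp: y_def i_def)
      have "norm (\<Prod>i\<in>I. Q s i) = norm (Q s i) * (\<Prod>i'\<in>I - {i}. norm (Q s i'))"
        unfolding prod_norm[symmetric] using i I(1) by (simp add: prod.remove)
      also have "\<dots> \<le> \<eta> * (\<Prod>i'\<in>I - {i}. 15)"
        using Qi Q15 \<open>\<eta> > 0\<close> by (intro mult_mono prod_mono) (auto intro!: prod_nonneg)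
      also have "\<dots> = \<eta> * 15 ^ (n - 1)" using i I by (simp add: n_def)
      also have "\<dots> \<le> \<eta> * 15 ^ n" using \<open>\<eta> > 0\<close> by (intro mult_left_mono power_increasing) auto
      also have "\<dots> = 1 / 4" by (simp add: \<eta>_def)
      finally show ?thesis .
    qed
    have expand: "(\<Prod>i\<in>I. Q s i) = (\<Sum>g\<in>X. C g * (ee (B g) * ee (real s * A g)))" for s
    proof -
      have "(\<Prod>i\<in>I. Q s i) = (\<Sum>g\<in>X. \<Prod>i\<in>I. c i (g i) * ee (of_int (g i) * y s i))"
        unfolding Q_def X_def using I F by (subst prod_sum_PiE) auto
      also have "\<dots> = (\<Sum>g\<in>X. C g * ee (\<Sum>i\<in>I. of_int (g i) * y s i))"
        by (simp add: prod.distrib C_def ee_sum[OF I(1)])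
      also have "\<dots> = (\<Sum>g\<in>X. C g * (ee (B g) * ee (real s * A g)))"
      proof (rule sum.cong[OF refl])
        fix g
        have "A g = (\<Sum>j\<in>J. \<Sum>k<H. of_int (g (j, k)) * real (p j) ^ k * \<alpha> j)"
          by (simp add: A_def N_def sum_distrib_right)
        also have "\<dots> = (\<Sum>i\<in>I. of_int (g i) * real (p (fst i)) ^ snd i * \<alpha> (fst i))"
          unfolding I_def sum.cartesian_product by (simp add: case_prod_beta)
        finally have "(\<Sum>i\<in>I. of_int (g i) * y s i) = B g + real s * A g"
          by (simp add: B_def y_def sum_distrib_left algebra_simps flip: sum.distrib)
        then show "C g * ee (\<Sum>i\<in>I. of_int (g i) * y s i) = C g * (ee (B g) * ee (real s * A g))"
          by (simp add: ee_add)
      qed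
      finally show ?thesis .
    qed
    \<comment> \<open>If every \<open>s\<close> fails, \<open>T\<close> is at most
      \<open>S / 4\<close>. But \<open>g0\<close> alone contributes exactly \<open>S\<close> to it
      and the other choices at most \<open>S / 2\<close>, a contradiction.\<close>
    define T where "T = (\<Sum>s=1..S. \<Prod>i\<in>I. Q s i)"
    define D where "D g = (\<Sum>s=1..S. ee (real s * A g))" for g
    have "norm T \<le> (\<Sum>s=1..S. 1 / 4)"
      unfolding T_def using prod_small by (rule sum_norm_le)
    then have T_up: "norm T \<le> real S / 4" by simp
    have "T = (\<Sum>g\<in>X. C g * ee (B g) * D g)"
      unfolding T_def expand D_def sum_distrib_left by (subst sum.swap) (simp add: mult_ac)
    also have "\<dots> = (\<Sum>g\<in>insert g0 G. C g * ee (B g) * D g)"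
      using X by (intro sum.mono_neutral_right) (auto simp: G_def)
    also have "\<dots> = C g0 * ee (B g0) * D g0 + (\<Sum>g\<in>G. C g * ee (B g) * D g)"
      using \<open>finite G\<close> by (subst sum.insert) (auto simp: G_def)
    also have "C g0 * ee (B g0) * D g0 = of_nat S"
    proof -
      have "B g0 = 0" by (auto simp: B_def g0_def)
      moreover have "N g0 j = 0" if "j \<in> J" for j using that by (auto simp: N_def g0_def I_def)
      then have "A g0 = 0" by (simp add: A_def)
      ultimately show ?thesis by (simp add: C0 D_def)
    qed
    finally have "norm (of_nat S :: complex) = norm (T - (\<Sum>g\<in>G. C g * ee (B g) * D g))" by simp
    also have "\<dots> \<le> norm T + norm (\<Sum>g\<in>G. C g * ee (B g) * D g)" by (rule norm_triangle_ineq4)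
    also have "norm (\<Sum>g\<in>G. C g * ee (B g) * D g) \<le> (\<Sum>g\<in>G. norm (C g) * norm (D g))"
      by (rule sum_norm_le) (simp add: norm_mult)
    also have "\<dots> \<le> real S / 2" using small unfolding D_def A_def .
    finally show False using T_up S by simp
  qed
  ultimately show ?thesis
    by (intro exI[of _ G] exI[of _ "\<lambda>g. norm (C g)"] exI[of _ N]) auto
qed

section \<open>A generic direction in the closure of the orbit\<close>

lemma ln_ratio_irrational:
  fixes p q :: nat
  assumes "prime p" "prime q" "p \<noteq> q"
  shows "ln (real p) / ln (real q) \<notin> \<rat>"
proof
  assume rat: "ln (real p) / ln (real q) \<in> \<rat>"
  have pq: "p > 1" "q > 1" using assms prime_gt_1_nat by auto
  then have pos: "ln (real p) > 0" "ln (real q) > 0" by auto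
  obtain m n :: nat where mn: "n \<noteq> 0" "\<bar>ln (real p) / ln (real q)\<bar> = real m / real n"
    using Rats_abs_nat_div_natE[OF rat] by metis
  then have "real n * ln (real p) = real m * ln (real q)"
    using pos by (simp add: field_simps)
  then have "ln (real p ^ n) = ln (real q ^ m)" using pq by (simp add: ln_realpow)
  then have "real p ^ n = real q ^ m" using pq by (subst (asm) ln_inj_iff) auto
  then have "p ^ n = q ^ m" by (simp flip: of_nat_power)
  then have "p dvd q ^ m" using mn(1) by (metis dvd_power not_gr_zero)
  then have "p dvd q" using assms(1) by (rule prime_dvd_power[rotated])
  then show False using assms primes_dvd_imp_eq by blast
qed

lemma kronecker_on_set:
  fixes \<theta> w :: "nat \<Rightarrow> real"
  assumes "finite B" "\<epsilon> > 0"
    and indep: "\<And>(u :: nat \<Rightarrow> int) (u0 :: int). (\<Sum>j\<in>B. of_int (u j) * \<theta> j) + of_int u0 = 0 \<Longrightarrow> \<forall>j\<in>B. u j = 0"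
  shows "\<exists>(n :: int) m. \<forall>j\<in>B. \<bar>of_int n * \<theta> j - of_int (m j) - w j\<bar> < \<epsilon>"
proof -
  \<comment> \<open>The reals as a module over the integers, which is where
    \<open>Kronecker_thm_2\<close> expresses independence.\<close>
  interpret Modules.module "\<lambda>r x. real_of_int r * x"
    by (simp add: Modules.module.intro distrib_left distrib_right mult.assoc)
  define N where "N = card B"
  obtain h where h: "bij_betw h {..<N} B"
    using ex_bij_betw_nat_finite[OF assms(1)] by (auto simp: N_def atLeast0LessThan)
  then have hB: "inj_on h {..<N}" "h ` {..<N} = B" by (auto simp: bij_betw_def)
  \<comment> \<open>The last entry 1 accounts for the integer constant \<open>u0\<close> in the
    relations.\<close>
  define \<theta>' where "\<theta>' i = (if i < N then \<theta> (h i) else 1)" for i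
  have zero: "\<forall>i\<le>N. u i = 0" if "(\<Sum>i\<le>N. of_int (u i) * \<theta>' i) = 0" for u :: "nat \<Rightarrow> int"
  proof -
    define g where "g = the_inv_into {..<N} h"
    have g: "g (h i) = i" if "i < N" for i
      unfolding g_def using hB(1) that by (intro the_inv_into_f_f) auto
    have "(\<Sum>j\<in>B. of_int (u (g j)) * \<theta> j) = (\<Sum>i<N. of_int (u i) * \<theta>' i)"
      using g by (subst sum.reindex_bij_betw[OF h, symmetric]) (simp add: \<theta>'_def)
    moreover have "(\<Sum>i\<le>N. of_int (u i) * \<theta>' i) = (\<Sum>i<N. of_int (u i) * \<theta>' i) + of_int (u N)"
      by (simp add: lessThan_Suc_atMost[symmetric] \<theta>'_def)
    ultimately have eq: "(\<Sum>j\<in>B. of_int (u (g j)) * \<theta> j) + of_int (u N) = 0" using that by simp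
    from indep[OF this] have B0: "\<forall>j\<in>B. u (g j) = 0" .
    then have "u N = 0" using eq by simp
    moreover have "u i = 0" if "i < N" for i
      using B0 hB(2) g[OF that] that by force
    ultimately show ?thesis by (metis le_neq_implies_less)
  qed
  \<comment> \<open>Independence of the image as a set does not see repeated values, so injectivity
    is derived separately from the absence of relations.\<close>
  have inj: "inj_on \<theta>' {..N}"
  proof (rule inj_onI, rule ccontr)
    fix a b assume ab: "a \<in> {..N}" "b \<in> {..N}" "\<theta>' a = \<theta>' b" "a \<noteq> b"
    define u :: "nat \<Rightarrow> int" where "u i = (if i = a then 1 else if i = b then -1 else 0)" for i
    have "(\<Sum>i\<le>N. of_int (u i) * \<theta>' i) = (\<Sum>i\<in>{a, b}. of_int (u i) * \<theta>' i)"
      using ab by (intro sum.mono_neutral_right) (auto simp: u_def)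
    also have "\<dots> = 0" using ab by (simp add: u_def)
    finally show False using zero[of u] ab(1) by (auto simp: u_def)
  qed
  have "independent (\<theta>' ` {..N})"
  proof
    assume "dependent (\<theta>' ` {..N})"
    then obtain f i where i: "i \<le> N" "f (\<theta>' i) \<noteq> 0"
      and f: "(\<Sum>x\<in>\<theta>' ` {..N}. real_of_int (f x) * x) = 0"
      unfolding dependent_finite[OF finite_imageI[OF finite_atMost]] by auto
    have "(\<Sum>i\<le>N. of_int (f (\<theta>' i)) * \<theta>' i) = 0" using f by (simp add: sum.reindex[OF inj])
    then show False using zero[of "\<lambda>i. f (\<theta>' i)"] i by auto
  qed
  then obtain k m where km: "\<And>i. i < N \<Longrightarrow> \<bar>of_int k * \<theta>' i - of_int (m i) - w (h i)\<bar> < \<epsilon>"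
    using Kronecker_thm_2[of \<theta>' N \<epsilon> "\<lambda>i. w (h i)"] inj \<open>\<epsilon> > 0\<close> by (auto simp: \<theta>'_def)
  have "\<bar>of_int k * \<theta> j - of_int (m (the_inv_into {..<N} h j)) - w j\<bar> < \<epsilon>" if jB: "j \<in> B" for j
  proof -
    obtain i where i: "i < N" "j = h i" using jB unfolding hB(2)[symmetric] by auto
    then show ?thesis using km[OF i(1)] hB(1) by (simp add: \<theta>'_def the_inv_into_f_f)
  qed
  then show ?thesis
    by (intro exI[of _ k] exI[of _ "\<lambda>j. m (the_inv_into {..<N} h j)"] ballI)
qed

text \<open>Irrationality of \<open>\<theta> i\<close> forces a nonzero coefficient in its expansion
  over the independent set, so \<open>v i\<close> is a nonzero polynomial in the parameter
  \<open>x\<close>. Irrationality of the ratios of the \<open>\<kappa>\<close> does the same for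
  \<open>v i * \<kappa> i - v l * \<kappa> l\<close>. A generic \<open>x\<close> therefore only has
  to avoid finitely many roots.\<close>

lemma kronecker_flow:
  fixes \<theta> \<kappa> :: "nat \<Rightarrow> real"
  assumes "finite J" and irr: "\<And>j. j \<in> J \<Longrightarrow> \<theta> j \<notin> \<rat>"
    and ratio: "\<And>i j. i \<in> J \<Longrightarrow> j \<in> J \<Longrightarrow> i \<noteq> j \<Longrightarrow> \<kappa> i / \<kappa> j \<notin> \<rat>"
    and nz: "\<And>j. j \<in> J \<Longrightarrow> \<kappa> j \<noteq> 0"
  shows "\<exists>v. (\<forall>j\<in>J. v j \<noteq> 0) \<and> inj_on (\<lambda>j. v j * \<kappa> j) J \<and>
    (\<forall>t \<epsilon>. \<epsilon> > 0 \<longrightarrow> (\<exists>(n :: int) k. \<forall>j\<in>J. \<bar>of_int n * \<theta> j - of_int (k j) - t * v j\<bar> < \<epsilon>))"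
proof -
  define indep where "indep B \<longleftrightarrow>
    (\<forall>(u :: nat \<Rightarrow> int) (u0 :: int). (\<Sum>j\<in>B. of_int (u j) * \<theta> j) + of_int u0 = 0 \<longrightarrow> (\<forall>j\<in>B. u j = 0))" for B
  have "indep {}" by (simp add: indep_def)
  then have ne: "{B. B \<subseteq> J \<and> indep B} \<noteq> {}" by blast
  have fin: "finite {B. B \<subseteq> J \<and> indep B}" using assms(1) by simp
  \<comment> \<open>Over a maximal independent set every \<open>\<theta> i\<close> is a rational combination, so the shifts \<open>w\<close> on \<open>B\<close>
    can be prescribed and determine the direction; they are taken to be powers of a generic \<open>x\<close>.\<close>
  obtain B where "B \<in> {B. B \<subseteq> J \<and> indep B}"
    and "\<forall>B'\<in>{B. B \<subseteq> J \<and> indep B}. B \<le> B' \<longrightarrow> B = B'"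
    using finite_has_maximal[OF fin ne] by (elim bexE)
  then have B: "B \<subseteq> J" "indep B" and maxB: "\<And>B'. B' \<subseteq> J \<Longrightarrow> indep B' \<Longrightarrow> B \<subseteq> B' \<Longrightarrow> B' = B"
    by auto
  have finB: "finite B" using B(1) assms(1) finite_subset by blast
  have rel: "\<exists>(q :: int) (c :: nat \<Rightarrow> int) (c0 :: int). q \<noteq> 0 \<and> of_int q * \<theta> i = (\<Sum>j\<in>B. of_int (c j) * \<theta> j) + of_int c0"
    if i: "i \<in> J" for i
  proof (cases "i \<in> B")
    case True
    have "(\<Sum>j\<in>B. of_int (if j = i then 1 else 0) * \<theta> j) = (\<Sum>j\<in>B. if j = i then \<theta> j else 0)"
      by (intro sum.cong) auto
    then have "of_int 1 * \<theta> i = (\<Sum>j\<in>B. of_int (if j = i then 1 else 0) * \<theta> j) + of_int 0"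
      using True finB by simp
    then show ?thesis by (metis zero_neq_one)
  next
    case False
    then have "\<not> indep (insert i B)" using maxB[of "insert i B"] i B(1) by blast
    then obtain u :: "nat \<Rightarrow> int" and u0 :: int
      where u: "(\<Sum>j\<in>insert i B. of_int (u j) * \<theta> j) + of_int u0 = 0" "\<exists>j\<in>insert i B. u j \<noteq> 0"
      unfolding indep_def by blast
    have eq: "of_int (u i) * \<theta> i + (\<Sum>j\<in>B. of_int (u j) * \<theta> j) + of_int u0 = 0"
      using u(1) False finB by simp
    have "u i \<noteq> 0"
    proof
      assume "u i = 0"
      then have "(\<Sum>j\<in>B. of_int (u j) * \<theta> j) + of_int u0 = 0" using eq by simp
      then have "\<forall>j\<in>B. u j = 0" using B(2) unfolding indep_def by blast
      then show False using u(2) \<open>u i = 0\<close> by auto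
    qed
    moreover have "of_int (u i) * \<theta> i = (\<Sum>j\<in>B. of_int (- u j) * \<theta> j) + of_int (- u0)"
      using eq by (simp add: sum_negf)
    ultimately show ?thesis
      by (intro exI[of _ "u i"] exI[of _ "\<lambda>j. - u j"] exI[of _ "- u0"] conjI)
  qed
  define rl where "rl i z \<longleftrightarrow> fst z \<noteq> 0 \<and>
      of_int (fst z) * \<theta> i = (\<Sum>j\<in>B. of_int (fst (snd z) j) * \<theta> j) + of_int (snd (snd z))"
    for i and z :: "int \<times> (nat \<Rightarrow> int) \<times> int"
  have "\<forall>i\<in>J. \<exists>z. rl i z"
  proof
    fix i assume "i \<in> J"
    from rel[OF this] obtain q :: int and c :: "nat \<Rightarrow> int" and c0 :: int
      where "q \<noteq> 0" "of_int q * \<theta> i = (\<Sum>j\<in>B. of_int (c j) * \<theta> j) + of_int c0" by (elim exE conjE)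
    then have "rl i (q, c, c0)" unfolding rl_def fst_conv snd_conv by (rule conjI)
    then show "\<exists>z. rl i z" by blast
  qed
  from bchoice[OF this] obtain z where "\<forall>i\<in>J. rl i (z i)" ..
  then have z: "\<forall>i\<in>J. fst (z i) \<noteq> 0 \<and>
      of_int (fst (z i)) * \<theta> i = (\<Sum>j\<in>B. of_int (fst (snd (z i)) j) * \<theta> j) + of_int (snd (snd (z i)))"
    unfolding rl_def .
  \<comment> \<open>A common denominator. At times \<open>Q * n\<close> each coordinate is an
    integer combination of the coordinates in \<open>B\<close> at time \<open>n\<close>, up to an
    integer, so approximation on \<open>B\<close> passes to all of \<open>J\<close> with a loss of
    at most \<open>Cs\<close>.\<close>
  define Q where "Q = (\<Prod>i\<in>J. fst (z i))"
  define R where "R i = (\<Prod>i'\<in>J - {i}. fst (z i'))" for i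
  define c where "c i j = R i * fst (snd (z i)) j" for i j
  define c0 where "c0 i = R i * snd (snd (z i))" for i
  have "Q \<noteq> 0" using z assms(1) by (simp add: Q_def prod_zero_iff)
  have Q: "of_int Q * \<theta> i = (\<Sum>j\<in>B. of_int (c i j) * \<theta> j) + of_int (c0 i)" if "i \<in> J" for i
  proof -
    have "Q = R i * fst (z i)"
      using assms(1) that by (simp add: Q_def R_def prod.remove mult.commute)
    then have "of_int Q * \<theta> i = of_int (R i) * ((\<Sum>j\<in>B. of_int (fst (snd (z i)) j) * \<theta> j) + of_int (snd (snd (z i))))"
      using z that by (simp add: mult.assoc)
    then show ?thesis by (simp add: c_def c0_def distrib_left sum_distrib_left mult.assoc)
  qed
  have c_nz: "\<exists>j\<in>B. c i j \<noteq> 0" if "i \<in> J" for i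
  proof (rule ccontr)
    assume "\<not> ?thesis"
    then have "of_int Q * \<theta> i = of_int (c0 i)" using Q[OF that] by simp
    then have "\<theta> i = of_int (c0 i) / of_int Q" using \<open>Q \<noteq> 0\<close> by (simp add: field_simps)
    then show False using irr[OF that] by simp
  qed
  define P where "P a = (\<Sum>j\<in>B. monom (a j) j)" for a :: "nat \<Rightarrow> real"
  have polyP: "poly (P a) x = (\<Sum>j\<in>B. a j * x ^ j)" for a x
    by (simp add: P_def poly_sum poly_monom)
  have P_nz: "P a \<noteq> 0" if "j \<in> B" "a j \<noteq> 0" for a j
  proof -
    have "coeff (P a) j = a j"
      using that(1) finB by (simp add: P_def coeff_sum)
    then show ?thesis using that(2) by auto
  qed
  define a where "a i j = real_of_int (c i j)" for i j
  define a2 where "a2 i l j = real_of_int (c i j) * \<kappa> i - real_of_int (c l j) * \<kappa> l" for i l j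
  have nz1: "P (a i) \<noteq> 0" if "i \<in> J" for i
    using c_nz[OF that] P_nz by (auto simp: a_def)
  have nz2: "P (a2 i l) \<noteq> 0" if "i \<in> J" "l \<in> J" "i \<noteq> l" for i l
  proof -
    obtain j where j: "j \<in> B" "c i j \<noteq> 0" using c_nz[OF \<open>i \<in> J\<close>] by blast
    have "a2 i l j \<noteq> 0"
    proof
      assume "a2 i l j = 0"
      then have "\<kappa> i / \<kappa> l = of_int (c l j) / of_int (c i j)"
        using j nz that by (simp add: a2_def field_simps)
      then show False using ratio[OF that] by simp
    qed
    then show ?thesis using P_nz j(1) by blast
  qed
  define bad where "bad = (\<Union>i\<in>J. {x. poly (P (a i)) x = 0}) \<union>
     (\<Union>(i, l)\<in>{(i, l). i \<in> J \<and> l \<in> J \<and> i \<noteq> l}. {x. poly (P (a2 i l)) x = 0})"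
  have "finite {(i, l). i \<in> J \<and> l \<in> J \<and> i \<noteq> l}"
    by (rule finite_subset[of _ "J \<times> J"]) (use assms(1) in auto)
  then have "finite bad"
    unfolding bad_def using assms(1) nz1 nz2 by (auto intro!: poly_roots_finite)
  then obtain x where x: "x \<notin> bad" using ex_new_if_finite[OF infinite_UNIV_char_0] by blast
  define w where "w j = x ^ j" for j :: nat
  define v where "v i = (\<Sum>j\<in>B. of_int (c i j) * w j)" for i
  have "\<forall>i\<in>J. v i \<noteq> 0"
    using x by (auto simp: bad_def polyP a_def v_def w_def)
  moreover have "inj_on (\<lambda>j. v j * \<kappa> j) J"
  proof (rule inj_onI, rule ccontr)
    fix i l assume il: "i \<in> J" "l \<in> J" "v i * \<kappa> i = v l * \<kappa> l" "i \<noteq> l"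
    have "poly (P (a2 i l)) x = v i * \<kappa> i - v l * \<kappa> l"
      by (simp add: polyP a2_def v_def w_def algebra_simps sum_distrib_left sum_subtractf)
    then show False using x il by (auto simp: bad_def)
  qed
  moreover have "\<exists>(n :: int) k. \<forall>j\<in>J. \<bar>of_int n * \<theta> j - of_int (k j) - t * v j\<bar> < \<epsilon>" if "\<epsilon> > 0" for t \<epsilon>
  proof -
    define Cs where "Cs = 1 + (\<Sum>i\<in>J. \<Sum>j\<in>B. \<bar>real_of_int (c i j)\<bar>)"
    have "Cs > 0" unfolding Cs_def by (intro add_pos_nonneg sum_nonneg) auto
    obtain n :: int and m :: "nat \<Rightarrow> int"
      where nm: "\<forall>j\<in>B. \<bar>of_int n * \<theta> j - of_int (m j) - t * w j\<bar> < \<epsilon> / Cs"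
      using kronecker_on_set[of B "\<epsilon> / Cs" \<theta> "\<lambda>j. t * w j"] finB \<open>Cs > 0\<close> \<open>\<epsilon> > 0\<close> B(2)
      unfolding indep_def by (metis divide_pos_pos)
    define k where "k i = (\<Sum>j\<in>B. c i j * m j) + n * c0 i" for i
    have "\<bar>of_int (Q * n) * \<theta> i - of_int (k i) - t * v i\<bar> < \<epsilon>" if i: "i \<in> J" for i
    proof -
      have "of_int (Q * n) * \<theta> i = of_int n * ((\<Sum>j\<in>B. of_int (c i j) * \<theta> j) + of_int (c0 i))"
        using Q[OF i] by (simp add: mult_ac)
      then have "of_int (Q * n) * \<theta> i - of_int (k i) - t * v i
          = (\<Sum>j\<in>B. of_int (c i j) * (of_int n * \<theta> j - of_int (m j) - t * w j))"
        by (simp add: k_def v_def algebra_simps sum_distrib_left sum.distrib sum_subtractf)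
      also have "\<bar>\<dots>\<bar> \<le> (\<Sum>j\<in>B. \<bar>real_of_int (c i j)\<bar> * (\<epsilon> / Cs))"
        using nm by (intro order_trans[OF sum_abs] sum_mono) (auto simp: abs_mult less_imp_le simp del: times_divide_eq_right intro!: mult_left_mono)
      also have "\<dots> = (\<Sum>j\<in>B. \<bar>real_of_int (c i j)\<bar>) * (\<epsilon> / Cs)" by (rule sum_distrib_right[symmetric])
      also have "\<dots> < Cs * (\<epsilon> / Cs)"
      proof (rule mult_strict_right_mono)
        have "(\<Sum>j\<in>B. \<bar>real_of_int (c i j)\<bar>) \<le> (\<Sum>i\<in>J. \<Sum>j\<in>B. \<bar>real_of_int (c i j)\<bar>)"
          using i assms(1) by (intro member_le_sum) (auto intro!: sum_nonneg)
        then show "(\<Sum>j\<in>B. \<bar>real_of_int (c i j)\<bar>) < Cs" by (simp add: Cs_def)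
      qed (use \<open>Cs > 0\<close> \<open>\<epsilon> > 0\<close> in auto)
      finally show ?thesis using \<open>Cs > 0\<close> by simp
    qed
    then show ?thesis by blast
  qed
  ultimately show ?thesis by blast
qed

section \<open>Averages along the orbit\<close>

text \<open>For \<open>T < 1\<close> the trivial bound 1 is enough, at the price of enlarging
  \<open>C\<close> by 1. This case arises because the parameter will be scaled down by a small
  constant.\<close>

lemma exp_sum_oscillation:
  fixes \<mu> :: "nat \<Rightarrow> real"
  assumes "finite J" "inj_on \<mu> J" "\<And>j. j \<in> J \<Longrightarrow> \<mu> j \<noteq> 0"
  shows "\<exists>C\<ge>0. \<forall>A a b T i. i \<in> J \<longrightarrow> T > 0 \<longrightarrow> \<bar>A i\<bar> \<ge> T ^ (card J + 1) \<longrightarrow> 0 \<le> a \<longrightarrow> a \<le> b \<longrightarrow> b \<le> 1 \<longrightarrow>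
    norm (integral {a..b} (\<lambda>t. cis (\<Sum>j\<in>J. A j * exp (\<mu> j * t)))) \<le> C / T"
proof -
  obtain C where C: "C \<ge> 0" "\<And>A a b T i. i \<in> J \<Longrightarrow> T \<ge> 1 \<Longrightarrow> \<bar>A i\<bar> \<ge> T ^ (card J + 1) \<Longrightarrow> 0 \<le> a \<Longrightarrow> a \<le> b \<Longrightarrow> b \<le> 1 \<Longrightarrow>
    norm (integral {a..b} (\<lambda>t. cis (\<Sum>j\<in>J. A j * exp (\<mu> j * t)))) \<le> C / T"
    using exp_sum_oscillation_large[OF assms] by blast
  have "norm (integral {a..b} (\<lambda>t. cis (\<Sum>j\<in>J. A j * exp (\<mu> j * t)))) \<le> (C + 1) / T"
    if i: "i \<in> J" and T: "T > 0" and A: "\<bar>A i\<bar> \<ge> T ^ (card J + 1)" and ab: "0 \<le> a" "a \<le> b" "b \<le> 1" for A a b T i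
  proof (cases "T \<ge> 1")
    case True
    then have "norm (integral {a..b} (\<lambda>t. cis (\<Sum>j\<in>J. A j * exp (\<mu> j * t)))) \<le> C / T"
      using C(2) i A ab by blast
    also have "\<dots> \<le> (C + 1) / T" using T by (intro divide_right_mono) auto
    finally show ?thesis .
  next
    case False
    define g where "g t = cis (\<Sum>j\<in>J. A j * exp (\<mu> j * t))" for t
    have "continuous_on {a..b} g"
      unfolding g_def cis_conv_exp by (intro continuous_intros)
    then have "(g has_integral integral {a..b} g) (cbox a b)"
      by (simp add: integrable_continuous_real integrable_integral)
    then have "norm (integral {a..b} g) \<le> 1 * (b - a)"
      using has_integral_bound[of 1 g "integral {a..b} g" a b] ab by (simp add: g_def)
    also have "\<dots> \<le> 1" using ab by simp
    also have "1 \<le> (C + 1) / T"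
      using T False C(1) by (simp add: field_simps)
    finally show ?thesis unfolding g_def .
  qed
  then show ?thesis using C(1) by (intro exI[of _ "C + 1"]) auto
qed

lemma riemann_sum_block:
  fixes f :: "nat \<Rightarrow> complex" and g :: "real \<Rightarrow> complex"
  assumes "L > 0" and cont: "continuous_on UNIV g" and "a \<le> b"
    and close: "\<And>l t. l \<in> {a..<b} \<Longrightarrow> real l / real L \<le> t \<Longrightarrow> t \<le> real (Suc l) / real L \<Longrightarrow> norm (f l - g t) \<le> \<delta>"
  shows "norm ((\<Sum>l\<in>{a..<b}. f l) / of_nat L - integral {real a / real L..real b / real L} g) \<le> real (b - a) * \<delta> / real L"
  using \<open>a \<le> b\<close> close
proof (induction b rule: dec_induct)
  case base
  then show ?case by simp
next
  case (step b)
  have int: "g integrable_on {x..y}" for x y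
    using cont continuous_on_subset integrable_continuous_real by blast
  define x where "x = real b / real L"
  define y where "y = real (Suc b) / real L"
  have xy: "x \<le> y" "y - x = 1 / real L" using assms(1) by (auto simp: x_def y_def field_simps)
  have IH: "norm ((\<Sum>l\<in>{a..<b}. f l) / of_nat L - integral {real a / real L..x} g) \<le> real (b - a) * \<delta> / real L"
    unfolding x_def by (rule step.IH) (use step.prems in auto)
  have "((\<lambda>t. f b - g t) has_integral ((y - x) *\<^sub>R f b - integral {x..y} g)) {x..y}"
    using xy by (intro has_integral_diff has_integral_const_real[THEN has_integral_eq_rhs] integrable_integral int) auto
  moreover have "norm (f b - g t) \<le> \<delta>" if "t \<in> {x..y}" for t
    using that step by (auto simp: x_def y_def)
  moreover from this[of x] have "\<delta> \<ge> 0" using xy(1) by (auto intro: order_trans[OF norm_ge_zero])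
  ultimately have "norm ((y - x) *\<^sub>R f b - integral {x..y} g) \<le> \<delta> * (y - x)"
    using has_integral_bound[of \<delta> "\<lambda>t. f b - g t" _ x y] xy(1) by simp
  then have piece: "norm (f b / of_nat L - integral {x..y} g) \<le> \<delta> / real L"
    unfolding xy(2) by (simp add: scaleR_conv_of_real mult.commute)
  have "integral {real a / real L..x} g + integral {x..y} g = integral {real a / real L..y} g"
    using step xy assms(1)
    by (intro Henstock_Kurzweil_Integration.integral_combine int) (auto simp: x_def divide_right_mono)
  note combine = this
  have "(\<Sum>l\<in>{a..<Suc b}. f l) / of_nat L - integral {real a / real L..y} g =
     ((\<Sum>l\<in>{a..<b}. f l) / of_nat L - integral {real a / real L..x} g) + (f b / of_nat L - integral {x..y} g)"
    unfolding combine[symmetric] using step.hyps(1) by (simp add: add_divide_distrib)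
  then have "norm ((\<Sum>l\<in>{a..<Suc b}. f l) / of_nat L - integral {real a / real L..y} g)
     \<le> real (b - a) * \<delta> / real L + \<delta> / real L"
    using norm_triangle_le[OF add_mono[OF IH piece]] by simp
  also have "\<dots> = real (Suc b - a) * \<delta> / real L"
    using step by (simp add: Suc_diff_le add_divide_distrib distrib_right)
  finally show ?case unfolding y_def .
qed

lemma convex_nat_set_eq_interval:
  fixes S :: "nat set"
  assumes "finite S" "S \<noteq> {}" and "\<And>a b c. a \<in> S \<Longrightarrow> c \<in> S \<Longrightarrow> a \<le> b \<Longrightarrow> b \<le> c \<Longrightarrow> b \<in> S"
  shows "S = {Min S..<Suc (Max S)}"
proof
  show "S \<subseteq> {Min S..<Suc (Max S)}" using assms(1) by (auto simp: less_Suc_eq_le)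
  show "{Min S..<Suc (Max S)} \<subseteq> S"
    using assms(3)[OF Min_in[OF assms(1,2)] Max_in[OF assms(1,2)]] by auto
qed

lemma powr_lipschitz:
  fixes p :: real
  assumes "p \<ge> 1" "u \<le> 1" "w \<le> 1"
  shows "\<bar>p powr u - p powr w\<bar> \<le> p * ln p * \<bar>u - w\<bar>"
  using assms(2,3)
proof (induction u w rule: linorder_wlog)
  case (le u w)
  show ?case
  proof (cases "u = w")
    case False
    then have "u < w" using le by simp
    have "\<And>x. ((\<lambda>u. p powr u) has_real_derivative p powr x * ln p) (at x)"
      using assms(1) by (auto intro!: derivative_eq_intros)
    from MVT2[OF \<open>u < w\<close> this]
    obtain z where z: "z < w" "p powr w - p powr u = (w - u) * (p powr z * ln p)" by blast
    have "p powr z \<le> p powr 1" using z le assms(1) by (intro powr_mono) auto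
    then have "(w - u) * (p powr z * ln p) \<le> (w - u) * (p * ln p)"
      using assms(1) \<open>u < w\<close> by (intro mult_left_mono mult_right_mono) auto
    moreover have "(w - u) * (p powr z * ln p) \<ge> 0"
      using assms(1) \<open>u < w\<close> by (intro mult_nonneg_nonneg) auto
    ultimately show ?thesis using z(2) \<open>u < w\<close> by (simp add: abs_minus_commute mult_ac)
  qed simp
qed (simp add: abs_minus_commute)

text \<open>The combination of the \<open>alpha (p j)\<close> continued to all integer times,
  because the shifts along the flow may be negative.\<close>

definition phase :: "nat set \<Rightarrow> (nat \<Rightarrow> nat) \<Rightarrow> (nat \<Rightarrow> real) \<Rightarrow> int \<Rightarrow> real" where
  "phase J p m x = (\<Sum>j\<in>J. m j * real (p j) powr (frac (of_int x * (ln 2 / ln (real (p j)))) - 1))"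

text \<open>Fractional parts jump, so the average along the flow is not one smooth oscillatory
  integral. Splitting by integer parts leaves at most \<open>card Bset\<close> blocks, a number
  independent of \<open>m\<close>, \<open>T\<close>, \<open>x\<close> and \<open>L\<close>, and on
  each block the average is close to an integral covered by
  \<open>exp_sum_oscillation\<close>.\<close>

lemma shifted_average_small:
  fixes J :: "nat set" and p :: "nat \<Rightarrow> nat"
  assumes "finite J" and p: "\<And>j. j \<in> J \<Longrightarrow> prime (p j) \<and> odd (p j)" and "inj_on p J"
  shows "\<exists>C\<ge>0. \<forall>m T \<epsilon> i. i \<in> J \<longrightarrow> T > 0 \<longrightarrow> \<bar>m i\<bar> \<ge> T ^ (card J + 1) \<longrightarrow> \<epsilon> > 0 \<longrightarrow>
    (\<exists>L \<nu>. L > 0 \<and> (\<forall>x. norm ((\<Sum>l<L. ee (phase J p m (x + \<nu> l))) / of_nat L) \<le> C / T + \<epsilon>))"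
proof -
  define \<theta> where "\<theta> j = ln 2 / ln (real (p j))" for j
  define \<kappa> where "\<kappa> j = ln (real (p j))" for j
  have p2: "real (p j) \<ge> 2" if "j \<in> J" for j
    using p[OF that] prime_ge_2_nat by fastforce
  have \<kappa>: "\<kappa> j > 0" if "j \<in> J" for j using p2[OF that] by (simp add: \<kappa>_def)
  have irr: "\<theta> j \<notin> \<rat>" if "j \<in> J" for j
  proof -
    have "2 \<noteq> p j" using p[OF that] by (metis even_numeral)
    then show ?thesis using ln_ratio_irrational[of 2 "p j"] p[OF that] by (simp add: \<theta>_def)
  qed
  have ratio: "\<kappa> i / \<kappa> j \<notin> \<rat>" if "i \<in> J" "j \<in> J" "i \<noteq> j" for i j
    unfolding \<kappa>_def using that p inj_onD[OF assms(3)] by (intro ln_ratio_irrational) auto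
  have "\<exists>v. (\<forall>j\<in>J. v j \<noteq> 0) \<and> inj_on (\<lambda>j. v j * \<kappa> j) J \<and>
    (\<forall>t \<epsilon>. \<epsilon> > 0 \<longrightarrow> (\<exists>(n :: int) k. \<forall>j\<in>J. \<bar>of_int n * \<theta> j - of_int (k j) - t * v j\<bar> < \<epsilon>))"
  proof (rule kronecker_flow[OF assms(1)])
    show "\<kappa> j \<noteq> 0" if "j \<in> J" for j using \<kappa>[OF that] by simp
  qed (fact irr ratio)+
  then obtain v where v: "\<forall>j\<in>J. v j \<noteq> 0" "inj_on (\<lambda>j. v j * \<kappa> j) J"
    and flow: "\<forall>t \<epsilon>. \<epsilon> > 0 \<longrightarrow> (\<exists>(n :: int) k. \<forall>j\<in>J. \<bar>of_int n * \<theta> j - of_int (k j) - t * v j\<bar> < \<epsilon>)"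
    by (elim exE conjE)
  define \<mu> where "\<mu> j = v j * \<kappa> j" for j
  have "\<mu> j \<noteq> 0" if "j \<in> J" for j using v(1) \<kappa>[OF that] that by (auto simp: \<mu>_def)
  moreover have "inj_on \<mu> J" using v(2) by (simp add: \<mu>_def[abs_def])
  ultimately obtain C0 where C0: "C0 \<ge> 0" "\<And>A a b T i. i \<in> J \<Longrightarrow> T > 0 \<Longrightarrow> \<bar>A i\<bar> \<ge> T ^ (card J + 1) \<Longrightarrow> 0 \<le> a \<Longrightarrow> a \<le> b \<Longrightarrow> b \<le> 1 \<Longrightarrow>
    norm (integral {a..b} (\<lambda>t. cis (\<Sum>j\<in>J. A j * exp (\<mu> j * t)))) \<le> C0 / T"
    using exp_sum_oscillation[OF assms(1), of \<mu>] by blast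
  define V where "V = nat \<lceil>\<Sum>j\<in>J. \<bar>v j\<bar>\<rceil>"
  have V: "\<bar>v j\<bar> \<le> real V" if "j \<in> J" for j
    using member_le_sum[OF that _ assms(1), of "\<lambda>j. \<bar>v j\<bar>"] by (simp add: V_def) linarith
  define q where "q = (\<Prod>j\<in>J. real (p j))"
  have q1: "q \<ge> 1" unfolding q_def using p2 by (intro prod_ge_1) force
  have pq: "real (p j) \<le> q" if "j \<in> J" for j
  proof -
    have "(\<Prod>j\<in>J - {j}. real (p j)) \<ge> 1" using p2 by (intro prod_ge_1) force
    then have "real (p j) * 1 \<le> real (p j) * (\<Prod>j\<in>J - {j}. real (p j))" by (intro mult_left_mono) auto
    then show ?thesis using that assms(1) by (simp add: q_def prod.remove)
  qed
  \<comment> \<open>On a block the coefficient of \<open>exp (\<mu> j * t)\<close> carries the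
    factor \<open>p j\<close> to the power \<open>y j - \<beta> j - 1\<close>. Flow and
    approximation errors keep the integer part \<open>\<beta> j\<close> below or at
    \<open>V + 2\<close>, so \<open>\<rho>\<close> bounds this factor from below.\<close>
  define \<rho> where "\<rho> = 1 / q ^ (V + 3)"
  have \<rho>: "0 < \<rho>" "\<rho> \<le> 1" using q1 by (auto simp: \<rho>_def)
  define Bset where "Bset = PiE J (\<lambda>_. {- (int V + 2)..int V + 2})"
  have finB: "finite Bset" using assms(1) by (auto simp: Bset_def intro!: finite_PiE)
  define C where "C = real (card Bset) * (C0 / \<rho>)"
  have "C \<ge> 0" using C0(1) \<rho> by (simp add: C_def)
  moreover have "\<exists>L \<nu>. L > 0 \<and> (\<forall>x. norm ((\<Sum>l<L. ee (phase J p m (x + \<nu> l))) / of_nat L) \<le> C / T + \<epsilon>)"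
    if i: "i \<in> J" and T: "T > 0" and mi: "\<bar>m i\<bar> \<ge> T ^ (card J + 1)" and \<epsilon>: "\<epsilon> > 0" for m T \<epsilon> i
  proof -
    define P where "P = (\<Sum>j\<in>J. \<bar>m j\<bar> * (real (p j) * \<kappa> j))"
    have "P \<ge> 0" unfolding P_def using \<kappa> by (intro sum_nonneg mult_nonneg_nonneg) (auto intro: less_imp_le)
    \<comment> \<open>Exponents will be known up to \<open>(V + 1) / L\<close>: \<open>V / L\<close>
      from moving \<open>t\<close> within a cell and \<open>1 / L\<close> from the Kronecker
      approximation. \<open>P\<close> measures how strongly the phase reacts to that.\<close>
    obtain L :: nat where L': "real L > max (real V + 2) (2 * pi * P * (real V + 1) / \<epsilon>)"
      using reals_Archimedean2 by blast
    then have L: "real L > real V + 2" "2 * pi * (P * ((real V + 1) / real L)) \<le> \<epsilon>" "L > 0"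
      using \<epsilon> by (auto simp: field_simps)
    define w where "w = Min ((\<lambda>j. \<bar>v j\<bar>) ` J)"
    have "w > 0"
      unfolding w_def using i v(1) assms(1) by (subst Min_gr_iff) auto
    moreover have "w \<le> \<bar>v j\<bar>" if "j \<in> J" for j
      using that assms(1) by (simp add: w_def)
    ultimately have w: "w > 0" "\<And>j. j \<in> J \<Longrightarrow> w \<le> \<bar>v j\<bar>" by auto
    \<comment> \<open>Consecutive steps of the flow have size \<open>\<bar>v j\<bar> / L\<close>; an
      error of at most half the smallest step cannot reverse their direction.\<close>
    define \<eta> where "\<eta> = min (1 / real L) (w / real L / 2)"
    have \<eta>: "\<eta> > 0" "\<eta> \<le> 1 / real L" using w L by (auto simp: \<eta>_def)
    have \<eta>v: "2 * \<eta> \<le> \<bar>v j\<bar> / real L" if "j \<in> J" for j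
    proof -
      have "2 * \<eta> \<le> w / real L" by (simp add: \<eta>_def)
      also have "\<dots> \<le> \<bar>v j\<bar> / real L" using w(2)[OF that] by (intro divide_right_mono) auto
      finally show ?thesis .
    qed
    define near where "near l z \<longleftrightarrow> (\<forall>j\<in>J. \<bar>of_int (fst z) * \<theta> j - of_int (snd z j) - real l / real L * v j\<bar> < \<eta>)"
      for l :: nat and z :: "int \<times> (nat \<Rightarrow> int)"
    have "\<forall>l. \<exists>z. near l z"
    proof
      fix l
      from flow \<eta>(1) obtain n :: int and k
        where "\<forall>j\<in>J. \<bar>of_int n * \<theta> j - of_int (k j) - real l / real L * v j\<bar> < \<eta>" by blast
      then have "near l (n, k)" unfolding near_def fst_conv snd_conv .
      then show "\<exists>z. near l z" ..
    qed
    from choice[OF this] obtain z where z: "\<forall>l. near l (z l)" ..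
    define \<nu> where "\<nu> l = fst (z l)" for l
    define k where "k l = snd (z l)" for l
    have nk: "\<bar>of_int (\<nu> l) * \<theta> j - of_int (k l j) - real l / real L * v j\<bar> < \<eta>" if "j \<in> J" for l j
      using z that by (simp add: near_def \<nu>_def k_def)
    have "norm ((\<Sum>l<L. ee (phase J p m (x + \<nu> l))) / of_nat L) \<le> C / T + \<epsilon>" for x :: int
    proof -
      define f where "f l = ee (phase J p m (x + \<nu> l))" for l
      define y where "y j = frac (of_int x * \<theta> j)" for j
      have y: "0 \<le> y j" "y j < 1" for j by (auto simp: y_def frac_lt_1)
      \<comment> \<open>Subtracting these integers gives a lift that follows
        \<open>y j + t * v j\<close> on the real line; its floor then records how often an integer
        has been crossed.\<close>
      define Y where "Y l j = of_int (x + \<nu> l) * \<theta> j - of_int (\<lfloor>of_int x * \<theta> j\<rfloor> + k l j)" for l j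
      define sh where "sh l j = real l / real L * v j" for l j
      have Yc: "\<bar>Y l j - (y j + sh l j)\<bar> < \<eta>" if "j \<in> J" for l j
        using nk[OF that, of l] by (simp add: sh_def Y_def y_def frac_def algebra_simps)
      define b where "b l = (\<lambda>j\<in>J. \<lfloor>Y l j\<rfloor>)" for l
      have fr: "frac (of_int (x + \<nu> l) * \<theta> j) = Y l j - of_int (b l j)" if "j \<in> J" for l j
        using that by (simp only: b_def restrict_apply' Y_def frac_def floor_diff_of_int of_int_diff)
      have lv: "\<bar>t * v j\<bar> \<le> real V" if "j \<in> J" "0 \<le> t" "t \<le> 1" for t j
        using V[OF that(1)] that mult_mono[of t 1 "\<bar>v j\<bar>" "real V"] by (simp add: abs_mult)
      have "1 / real L < 1" using L(1) by simp
      then have \<eta>1: "\<eta> < 1" using \<eta>(2) by linarith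
      have bB: "b l \<in> Bset" if "l < L" for l
      proof -
        have "\<lfloor>Y l j\<rfloor> \<in> {- (int V + 2)..int V + 2}" if "j \<in> J" for j
        proof -
          have "\<bar>sh l j\<bar> \<le> real V" unfolding sh_def using \<open>l < L\<close> by (intro lv that) auto
          then have "- (real V + 1) < Y l j \<and> Y l j < real V + 2"
            using Yc[OF that, of l] \<eta>1 y[of j] unfolding abs_le_iff abs_less_iff by linarith
          then show ?thesis by (auto simp: le_floor_iff floor_le_iff)
        qed
        then show ?thesis by (auto simp: Bset_def b_def)
      qed
      \<comment> \<open>\<open>Y l j\<close> is monotone in \<open>l\<close>, so each vector of integer parts is attained on an interval of \<open>l\<close>.\<close>
      have convex: "b l' = b l1" if "l1 \<le> l'" "l' \<le> l2" "b l1 = b l2" for l1 l' l2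
      proof (rule extensionalityI[of _ J])
        fix j assume j: "j \<in> J"
        have eq: "\<lfloor>Y l1 j\<rfloor> = \<lfloor>Y l2 j\<rfloor>" using that(3) j by (metis b_def restrict_apply')
        have stepd: "\<bar>Y (Suc l) j - Y l j - v j / real L\<bar> < 2 * \<eta>" for l
        proof -
          have "sh (Suc l) j = sh l j + v j / real L"
            by (simp add: sh_def add_divide_distrib distrib_right)
          then show ?thesis using Yc[OF j, of l] Yc[OF j, of "Suc l"] by linarith
        qed
        have "\<lfloor>Y l' j\<rfloor> = \<lfloor>Y l1 j\<rfloor>"
        proof (cases "v j > 0")
          case True
          have "Y l j \<le> Y (Suc l) j" for l
            using stepd[of l] \<eta>v[OF j] True by simp
          then have "Y l1 j \<le> Y l' j" "Y l' j \<le> Y l2 j"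
            using that(1,2) lift_Suc_mono_le[of "\<lambda>l. Y l j"] by auto
          then have "\<lfloor>Y l1 j\<rfloor> \<le> \<lfloor>Y l' j\<rfloor>" "\<lfloor>Y l' j\<rfloor> \<le> \<lfloor>Y l2 j\<rfloor>" by (auto intro: floor_mono)
          then show ?thesis using eq by linarith
        next
          case False
          have "Y l j \<ge> Y (Suc l) j" for l
            using stepd[of l] \<eta>v[OF j] False by (simp add: abs_if split: if_splits)
          then have "Y l' j \<le> Y l1 j" "Y l2 j \<le> Y l' j"
            using that(1,2) lift_Suc_antimono_le[of "\<lambda>l. Y l j"] by auto
          then have "\<lfloor>Y l' j\<rfloor> \<le> \<lfloor>Y l1 j\<rfloor>" "\<lfloor>Y l2 j\<rfloor> \<le> \<lfloor>Y l' j\<rfloor>" by (auto intro: floor_mono)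
          then show ?thesis using eq by linarith
        qed
        then show "b l' j = b l1 j" using j by (simp add: b_def)
      qed (auto simp: b_def)
      define S where "S \<beta> = {l \<in> {..<L}. b l = \<beta>}" for \<beta>
      have block: "norm ((\<Sum>l\<in>S \<beta>. f l) / of_nat L) \<le> C0 / \<rho> / T + real (card (S \<beta>)) * \<epsilon> / real L"
        if \<beta>: "\<beta> \<in> Bset" for \<beta>
      proof (cases "S \<beta> = {}")
        case True
        then show ?thesis using C0(1) \<rho> T by simp
      next
        case False
        have "finite (S \<beta>)" by (simp add: S_def)
        moreover have "l' \<in> S \<beta>" if "l1 \<in> S \<beta>" "l2 \<in> S \<beta>" "l1 \<le> l'" "l' \<le> l2" for l1 l' l2
          using that convex[of l1 l' l2] by (auto simp: S_def)
        ultimately obtain a c where ac: "S \<beta> = {a..<c}"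
          using convex_nat_set_eq_interval[of "S \<beta>"] False by metis
        have acL: "a \<le> c" "c \<le> L"
        proof -
          show "a \<le> c" using False ac by auto
          show "c \<le> L"
          proof (rule ccontr)
            assume "\<not> c \<le> L"
            then have "c - 1 \<in> S \<beta>" using False ac by auto
            then show False using \<open>\<not> c \<le> L\<close> by (auto simp: S_def)
          qed
        qed
        define A where "A j = 2 * pi * m j * real (p j) powr (y j - of_int (\<beta> j) - 1)" for j
        define g where "g t = cis (\<Sum>j\<in>J. A j * exp (\<mu> j * t))" for t
        have g: "g t = ee (\<Sum>j\<in>J. m j * real (p j) powr (y j + t * v j - of_int (\<beta> j) - 1))" for t
        proof -
          have "A j * exp (\<mu> j * t) = 2 * pi * (m j * real (p j) powr (y j + t * v j - of_int (\<beta> j) - 1))"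
            if "j \<in> J" for j
          proof -
            have "real (p j) powr (y j + t * v j - of_int (\<beta> j) - 1)
              = real (p j) powr (y j - of_int (\<beta> j) - 1) * real (p j) powr (t * v j)"
              by (simp flip: powr_add add: algebra_simps)
            also have "real (p j) powr (t * v j) = exp (\<mu> j * t)"
              using p2[OF that] by (simp add: powr_def \<mu>_def \<kappa>_def mult_ac)
            finally show ?thesis by (simp add: A_def)
          qed
          then show ?thesis by (simp add: g_def ee_def sum_distrib_left)
        qed
        have "continuous_on UNIV g"
          unfolding g_def cis_conv_exp by (intro continuous_intros)
        moreover have "norm (f l - g t) \<le> \<epsilon>"
          if l: "l \<in> {a..<c}" and t: "real l / real L \<le> t" "t \<le> real (Suc l) / real L" for l t
        proof -
          have "l \<in> S \<beta>" using l unfolding ac .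
          then have bl: "b l = \<beta>" unfolding S_def by blast
          define e1 where "e1 j = Y l j - of_int (\<beta> j) - 1" for j
          define e2 where "e2 j = y j + t * v j - of_int (\<beta> j) - 1" for j
          have ed: "\<bar>e1 j - e2 j\<bar> \<le> (real V + 1) / real L" "e1 j \<le> 1" "e2 j \<le> 1" if j: "j \<in> J" for j
          proof -
            have "t - real l / real L \<le> 1 / real L" using t by (simp add: add_divide_distrib)
            then have "(t - real l / real L) * \<bar>v j\<bar> \<le> 1 / real L * real V"
              using t V[OF j] L(3) by (intro mult_mono) auto
            then have "\<bar>(t - real l / real L) * v j\<bar> \<le> real V / real L"
              using t by (simp add: abs_mult)
            moreover have "e1 j - e2 j = (Y l j - (y j + sh l j)) - (t - real l / real L) * v j"
              by (simp add: e1_def e2_def sh_def algebra_simps)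
            ultimately show *: "\<bar>e1 j - e2 j\<bar> \<le> (real V + 1) / real L"
              using Yc[OF j, of l] \<eta>(2) unfolding add_divide_distrib by linarith
            \<comment> \<open>\<open>powr_lipschitz\<close> needs exponents at most 1:
              \<open>e1 j\<close> is a fractional part minus 1, and \<open>e2 j\<close> lies within
              1 of it.\<close>
            have "e1 j < 0"
              using fr[OF j, of l] frac_lt_1[of "of_int (x + \<nu> l) * \<theta> j"] unfolding bl e1_def by linarith
            moreover have "(real V + 1) / real L \<le> 1" using L by (simp add: field_simps)
            ultimately show "e1 j \<le> 1" "e2 j \<le> 1" using * by linarith+
          qed
          have fl: "f l = ee (\<Sum>j\<in>J. m j * real (p j) powr e1 j)"
            using fr[of _ l] unfolding f_def phase_def e1_def bl \<theta>_def by simp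
          have "norm (f l - g t) \<le> 2 * pi * \<bar>(\<Sum>j\<in>J. m j * real (p j) powr e1 j) - (\<Sum>j\<in>J. m j * real (p j) powr e2 j)\<bar>"
            unfolding fl g e2_def by (rule norm_ee_diff_le)
          also have "\<dots> \<le> 2 * pi * (P * ((real V + 1) / real L))"
          proof (intro mult_left_mono)
            have "(\<Sum>j\<in>J. m j * real (p j) powr e1 j) - (\<Sum>j\<in>J. m j * real (p j) powr e2 j)
               = (\<Sum>j\<in>J. m j * (real (p j) powr e1 j - real (p j) powr e2 j))"
              by (simp add: sum_subtractf right_diff_distrib)
            also have "\<bar>\<dots>\<bar> \<le> (\<Sum>j\<in>J. \<bar>m j\<bar> * (real (p j) * \<kappa> j) * ((real V + 1) / real L))"
            proof (intro order_trans[OF sum_abs] sum_mono)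
              fix j assume j: "j \<in> J"
              have "\<bar>real (p j) powr e1 j - real (p j) powr e2 j\<bar> \<le> real (p j) * ln (real (p j)) * \<bar>e1 j - e2 j\<bar>"
                using p2[OF j] ed[OF j] by (intro powr_lipschitz) auto
              also have "\<dots> \<le> real (p j) * \<kappa> j * ((real V + 1) / real L)"
                unfolding \<kappa>_def using p2[OF j] ed[OF j] by (intro mult_left_mono) auto
              finally show "\<bar>m j * (real (p j) powr e1 j - real (p j) powr e2 j)\<bar>
                  \<le> \<bar>m j\<bar> * (real (p j) * \<kappa> j) * ((real V + 1) / real L)"
                unfolding abs_mult mult.assoc by (rule mult_left_mono) simp
            qed
            also have "\<dots> = P * ((real V + 1) / real L)" unfolding P_def by (rule sum_distrib_right[symmetric])
            finally show "\<bar>(\<Sum>j\<in>J. m j * real (p j) powr e1 j) - (\<Sum>j\<in>J. m j * real (p j) powr e2 j)\<bar> \<le> P * ((real V + 1) / real L)" .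
          qed simp
          also have "\<dots> \<le> \<epsilon>" by (rule L(2))
          finally show ?thesis .
        qed
        ultimately have "norm ((\<Sum>l\<in>{a..<c}. f l) / of_nat L - integral {real a / real L..real c / real L} g)
            \<le> real (c - a) * \<epsilon> / real L"
          by (intro riemann_sum_block[OF L(3) _ acL(1)])
        moreover have "norm (integral {real a / real L..real c / real L} g) \<le> C0 / (\<rho> * T)"
          unfolding g_def
        proof (rule C0(2)[OF i])
          have "(\<rho> * T) ^ (card J + 1) \<le> \<rho> * \<bar>m i\<bar>"
            unfolding power_mult_distrib using \<rho> mi T power_decreasing[of 1 "card J + 1" \<rho>]
            by (intro mult_mono) auto
          also have "\<dots> \<le> real (p i) powr (y i - of_int (\<beta> i) - 1) * \<bar>m i\<bar>"
          proof (rule mult_right_mono)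
            have "\<beta> i \<le> int V + 2" using \<beta> i by (auto simp: Bset_def)
            then have "- real (V + 3) \<le> y i - of_int (\<beta> i) - 1" using y(1)[of i] by simp
            then have "real (p i) powr (- real (V + 3)) \<le> real (p i) powr (y i - of_int (\<beta> i) - 1)"
              using p2[OF i] by (intro powr_mono) auto
            moreover have "\<rho> \<le> real (p i) powr (- real (V + 3))"
              unfolding \<rho>_def powr_minus_divide using p2[OF i] pq[OF i]
              by (subst powr_realpow) (auto intro!: divide_left_mono power_mono)
            ultimately show "\<rho> \<le> real (p i) powr (y i - of_int (\<beta> i) - 1)" by linarith
          qed simp
          also have "\<dots> \<le> \<bar>A i\<bar>"
          proof -
            have "1 \<le> 2 * pi" using pi_ge_two by linarith
            then have "1 * (real (p i) powr (y i - of_int (\<beta> i) - 1) * \<bar>m i\<bar>) \<le> 2 * pi * (real (p i) powr (y i - of_int (\<beta> i) - 1) * \<bar>m i\<bar>)"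
              by (intro mult_right_mono) auto
            then show ?thesis by (simp add: A_def abs_mult mult_ac)
          qed
          finally show "(\<rho> * T) ^ (card J + 1) \<le> \<bar>A i\<bar>" .
        qed (use \<rho> T acL L in \<open>auto simp: divide_right_mono\<close>)
        ultimately show ?thesis
          using norm_triangle_sub[of "(\<Sum>l\<in>{a..<c}. f l) / of_nat L" "integral {real a / real L..real c / real L} g"]
          unfolding ac divide_divide_eq_left card_atLeastLessThan by linarith
      qed
      have bimg: "b ` {..<L} \<subseteq> Bset" using bB by auto
      have "(\<Sum>l<L. f l) / of_nat L = (\<Sum>\<beta>\<in>Bset. (\<Sum>l\<in>S \<beta>. f l) / of_nat L)"
        unfolding sum_divide_distrib[symmetric] S_def by (subst sum.group[OF _ finB bimg]) auto
      then have "norm ((\<Sum>l<L. f l) / of_nat L) \<le> (\<Sum>\<beta>\<in>Bset. C0 / \<rho> / T + real (card (S \<beta>)) * \<epsilon> / real L)"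
        using block by (auto intro: sum_norm_le)
      also have "\<dots> = C / T + (\<Sum>\<beta>\<in>Bset. real (card (S \<beta>))) * \<epsilon> / real L"
        by (simp add: sum.distrib C_def sum_distrib_right sum_divide_distrib)
      also have "(\<Sum>\<beta>\<in>Bset. real (card (S \<beta>))) = real L"
      proof -
        have "(\<Sum>\<beta>\<in>Bset. \<Sum>l\<in>S \<beta>. (1 :: real)) = (\<Sum>l<L. 1)"
          unfolding S_def by (rule sum.group[OF _ finB bimg]) auto
        then show ?thesis by simp
      qed
      finally show ?thesis using L(3) by (simp add: f_def)
    qed
    then show ?thesis using L(3) by blast
  qed
  ultimately show ?thesis by blast
qed

section \<open>From shifted averages to mean squares\<close>

lemma norm_sum_shift_le:
  fixes f :: "int \<Rightarrow> complex"
  assumes "\<And>n. norm (f n) \<le> 1"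
  shows "norm ((\<Sum>n\<in>{1..int N}. f n) - (\<Sum>n\<in>{1..int N}. f (n + k))) \<le> 2 * \<bar>of_int k\<bar>"
proof -
  define A where "A = {1..int N}"
  define B where "B = {1 + k..int N + k}"
  have "B = (\<lambda>n. n + k) ` A" by (simp add: A_def B_def add.commute)
  then have B: "(\<Sum>n\<in>A. f (n + k)) = (\<Sum>n\<in>B. f n)" by (simp add: sum.reindex)
  have fin: "finite A" "finite B" by (auto simp: A_def B_def)
  have "(\<Sum>n\<in>A. f n) - (\<Sum>n\<in>B. f n) = (\<Sum>n\<in>A - B. f n) - (\<Sum>n\<in>B - A. f n)"
    using sum.Int_Diff[OF fin(1), of f B] sum.Int_Diff[OF fin(2), of f A] by (simp add: Int_commute)
  then have "norm ((\<Sum>n\<in>A. f n) - (\<Sum>n\<in>B. f n)) \<le> norm (\<Sum>n\<in>A - B. f n) + norm (\<Sum>n\<in>B - A. f n)"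
    by (simp add: norm_triangle_ineq4)
  also have "\<dots> \<le> real (card (A - B)) + real (card (B - A))"
    using sum_norm_le[of "A - B" f "\<lambda>_. 1"] sum_norm_le[of "B - A" f "\<lambda>_. 1"] assms by (intro add_mono) auto
  also have "card (A - B) \<le> nat \<bar>k\<bar>"
  proof -
    have "A - B \<subseteq> (if k \<ge> 0 then {1..k} else {int N + k + 1..int N})" by (auto simp: A_def B_def)
    then have "card (A - B) \<le> card (if k \<ge> 0 then {1..k} else {int N + k + 1..int N})" by (intro card_mono) auto
    then show ?thesis by (auto split: if_splits)
  qed
  also have "card (B - A) \<le> nat \<bar>k\<bar>"
  proof -
    have "B - A \<subseteq> (if k \<ge> 0 then {int N + 1..int N + k} else {1 + k..0})" by (auto simp: A_def B_def)
    then have "card (B - A) \<le> card (if k \<ge> 0 then {int N + 1..int N + k} else {1 + k..0})" by (intro card_mono) auto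
    then show ?thesis by (auto split: if_splits)
  qed
  finally show ?thesis unfolding B[symmetric] unfolding A_def by simp
qed

text \<open>Replacing the sum over \<open>n\<close> by its average over the shifts costs a constant
  \<open>M\<close> independent of \<open>N\<close>, which is below \<open>N / T\<close> once
  \<open>N \<ge> M * T\<close>. That threshold depends on \<open>m\<close> and \<open>T\<close>, but
  \<open>C\<close> does not.\<close>

lemma sum_ee_alpha_small:
  fixes J :: "nat set" and p :: "nat \<Rightarrow> nat"
  assumes "finite J" and p: "\<And>j. j \<in> J \<Longrightarrow> prime (p j) \<and> odd (p j)" and "inj_on p J"
  shows "\<exists>C\<ge>0. \<forall>m T i. i \<in> J \<longrightarrow> T > 0 \<longrightarrow> \<bar>m i\<bar> \<ge> T ^ (card J + 1) \<longrightarrow>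
    (\<forall>\<^sub>F N in sequentially. norm (\<Sum>n=1..N. ee (\<Sum>j\<in>J. m j * alpha (p j) n)) \<le> C / T * real N)"
proof -
  obtain C where C: "C \<ge> 0" "\<And>m T \<epsilon> i. i \<in> J \<Longrightarrow> T > 0 \<Longrightarrow> \<bar>m i\<bar> \<ge> T ^ (card J + 1) \<Longrightarrow> \<epsilon> > 0 \<Longrightarrow>
    (\<exists>L \<nu>. L > 0 \<and> (\<forall>x. norm ((\<Sum>l<L. ee (phase J p m (x + \<nu> l))) / of_nat L) \<le> C / T + \<epsilon>))"
    using shifted_average_small[OF assms] by blast
  have "\<forall>\<^sub>F N in sequentially. norm (\<Sum>n=1..N. ee (\<Sum>j\<in>J. m j * alpha (p j) n)) \<le> (C + 2) / T * real N"
    if i: "i \<in> J" and T: "T > 0" and mi: "\<bar>m i\<bar> \<ge> T ^ (card J + 1)" for m T i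
  proof -
    obtain L \<nu> where L: "L > 0" and avg: "\<And>x. norm ((\<Sum>l<L. ee (phase J p m (x + \<nu> l))) / of_nat L) \<le> C / T + 1 / T"
      using C(2)[of i T m "1 / T"] i T mi by auto
    define f where "f x = ee (phase J p m x)" for x
    define M where "M = (\<Sum>l<L. 2 * \<bar>real_of_int (\<nu> l)\<bar>)"
    have "norm (\<Sum>n=1..N. ee (\<Sum>j\<in>J. m j * alpha (p j) n)) \<le> (C + 2) / T * real N" if N: "real N \<ge> M * T" for N
    proof -
      have "int ` {1..N} = {1..int N}" by (simp add: image_int_atLeastAtMost)
      then have "(\<Sum>n\<in>{1..int N}. f n) = (\<Sum>n=1..N. f (int n))"
        by (metis (no_types, lifting) inj_on_of_nat sum.cong sum.reindex_cong)
      then have eq: "(\<Sum>n=1..N. ee (\<Sum>j\<in>J. m j * alpha (p j) n)) = (\<Sum>n\<in>{1..int N}. f n)"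
        by (simp add: f_def phase_def alpha_def)
      define X where "X = (\<Sum>n\<in>{1..int N}. f n)"
      define d where "d l = X - (\<Sum>n\<in>{1..int N}. f (n + \<nu> l))" for l
      have "(\<Sum>l<L. d l) = of_nat L * X - (\<Sum>n\<in>{1..int N}. \<Sum>l<L. f (n + \<nu> l))"
        unfolding d_def sum_subtractf by (subst sum.swap) simp
      then have "X = (\<Sum>l<L. d l) / of_nat L + (\<Sum>n\<in>{1..int N}. (\<Sum>l<L. f (n + \<nu> l)) / of_nat L)"
        using L by (simp add: field_simps flip: sum_divide_distrib)
      then have "norm X \<le> norm ((\<Sum>l<L. d l) / of_nat L) + norm (\<Sum>n\<in>{1..int N}. (\<Sum>l<L. f (n + \<nu> l)) / of_nat L)"
        by (metis norm_triangle_ineq)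
      also have "norm ((\<Sum>l<L. d l) / of_nat L) \<le> M"
      proof -
        have "norm (\<Sum>l<L. d l) \<le> M"
          unfolding M_def d_def X_def by (intro sum_norm_le norm_sum_shift_le) (simp add: f_def)
        moreover have "norm (\<Sum>l<L. d l) / real L \<le> norm (\<Sum>l<L. d l)"
          using L by (simp add: divide_le_eq mult_le_cancel_left1)
        ultimately show ?thesis by (simp add: norm_divide)
      qed
      also have "norm (\<Sum>n\<in>{1..int N}. (\<Sum>l<L. f (n + \<nu> l)) / of_nat L) \<le> (\<Sum>n\<in>{1..int N}. C / T + 1 / T)"
        unfolding f_def by (intro sum_norm_le avg)
      also have "\<dots> = (C + 1) / T * real N" by (simp add: add_divide_distrib)
      also have "M \<le> 1 / T * real N" using N T by (simp add: field_simps)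
      finally show ?thesis unfolding eq X_def by (simp add: add_divide_distrib algebra_simps)
    qed
    moreover have "\<forall>\<^sub>F N in sequentially. real N \<ge> M * T"
      using filterlim_real_sequentially unfolding filterlim_at_top by blast
    ultimately show ?thesis by (rule eventually_mono[rotated])
  qed
  then show ?thesis using C(1) by (intro exI[of _ "C + 2"]) auto
qed

text \<open>Expanding the square gives pairs of values of \<open>s\<close> with difference
  \<open>d z\<close>. At most \<open>2 * S * T ^ (card J + 1)\<close> pairs are close and are
  bounded trivially. For the others the frequency \<open>d z * m i\<close> is at least
  \<open>T ^ (card J + 1)\<close> in absolute value, because \<open>m i\<close> is a nonzero
  integer.\<close>

lemma mean_square_small:
  fixes J :: "nat set" and p :: "nat \<Rightarrow> nat"
  assumes "finite J" and p: "\<And>j. j \<in> J \<Longrightarrow> prime (p j) \<and> odd (p j)" and "inj_on p J"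
  shows "\<exists>C\<ge>0. \<forall>(m :: nat \<Rightarrow> int) (T :: nat) S. (\<exists>i\<in>J. m i \<noteq> 0) \<longrightarrow> T > 0 \<longrightarrow>
    (\<forall>\<^sub>F N in sequentially. (\<Sum>n=1..N. (norm (\<Sum>s=1..S. ee (real s * (\<Sum>j\<in>J. of_int (m j) * alpha (p j) n))))\<^sup>2)
      \<le> real N * (2 * real S * real T ^ (card J + 1) + (real S)\<^sup>2 * C / real T))"
proof -
  obtain C where C: "C \<ge> 0" "\<And>m T i. i \<in> J \<Longrightarrow> T > 0 \<Longrightarrow> \<bar>m i\<bar> \<ge> T ^ (card J + 1) \<Longrightarrow>
    (\<forall>\<^sub>F N in sequentially. norm (\<Sum>n=1..N. ee (\<Sum>j\<in>J. m j * alpha (p j) n)) \<le> C / T * real N)"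
    using sum_ee_alpha_small[OF assms] by blast
  have "\<forall>\<^sub>F N in sequentially. (\<Sum>n=1..N. (norm (\<Sum>s=1..S. ee (real s * (\<Sum>j\<in>J. of_int (m j) * alpha (p j) n))))\<^sup>2)
      \<le> real N * (2 * real S * real T ^ (card J + 1) + (real S)\<^sup>2 * C / real T)"
    if i: "i \<in> J" "m i \<noteq> 0" and T: "T > 0" for m :: "nat \<Rightarrow> int" and T S :: nat and i
  proof -
    define K where "K = T ^ (card J + 1)"
    define X where "X n = (\<Sum>j\<in>J. of_int (m j) * alpha (p j) n)" for n
    define Z where "Z = {..<S} \<times> {..<S}"
    define d where "d z = int (fst z) - int (snd z)" for z :: "nat \<times> nat"
    define far where "far = {z \<in> Z. \<bar>d z\<bar> \<ge> int K}"
    define E where "E N z = (\<Sum>n=1..N. ee (of_int (d z) * X n))" for N z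
    have finZ: "finite Z" by (simp add: Z_def)
    have "\<forall>\<^sub>F N in sequentially. norm (E N z) \<le> C / real T * real N" if z: "z \<in> far" for z
    proof -
      have "\<bar>d z\<bar> * 1 \<le> \<bar>d z\<bar> * \<bar>m i\<bar>" using i(2) by (intro mult_left_mono) auto
      then have "int K \<le> \<bar>d z * m i\<bar>" using z by (simp add: far_def abs_mult)
      then have "real_of_int (int K) \<le> real_of_int \<bar>d z * m i\<bar>" by (simp only: of_int_le_iff)
      then have "\<bar>real_of_int (d z) * real_of_int (m i)\<bar> \<ge> real T ^ (card J + 1)" by (simp add: K_def)
      then show ?thesis
        using C(2)[of i "real T" "\<lambda>j. of_int (d z) * of_int (m j)"] i(1) T
        by (simp add: E_def X_def sum_distrib_left mult.assoc)
    qed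
    then have "\<forall>\<^sub>F N in sequentially. \<forall>z\<in>far. norm (E N z) \<le> C / real T * real N"
      using finZ by (intro eventually_ball_finite) (auto simp: far_def)
    then show ?thesis
    proof (rule eventually_mono)
      fix N assume N: "\<forall>z\<in>far. norm (E N z) \<le> C / real T * real N"
      have sq: "of_real ((norm (\<Sum>s=1..S. ee (real s * X n)))\<^sup>2) = (\<Sum>z\<in>Z. ee (of_int (d z) * X n))" for n
      proof -
        have "(\<Sum>s=1..S. ee (real s * X n)) = ee (X n) * (\<Sum>s<S. ee (real s * X n))"
          by (simp only: One_nat_def sum.atLeast1_atMost_eq) (simp add: sum_distrib_left distrib_right ee_add)
        then have "norm (\<Sum>s=1..S. ee (real s * X n)) = norm (\<Sum>s<S. ee (real s * X n))"
          by (simp add: norm_mult)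
        then show ?thesis unfolding Z_def d_def sum_ee_pairs by simp
      qed
      have "complex_of_real (\<Sum>n=1..N. (norm (\<Sum>s=1..S. ee (real s * X n)))\<^sup>2) = (\<Sum>z\<in>Z. E N z)"
        unfolding of_real_sum sq E_def by (rule sum.swap)
      then have "norm (complex_of_real (\<Sum>n=1..N. (norm (\<Sum>s=1..S. ee (real s * X n)))\<^sup>2)) = norm (\<Sum>z\<in>Z. E N z)"
        by simp
      then have "(\<Sum>n=1..N. (norm (\<Sum>s=1..S. ee (real s * X n)))\<^sup>2) = norm (\<Sum>z\<in>Z. E N z)"
        unfolding norm_of_real by (subst (asm) abs_of_nonneg) (auto intro!: sum_nonneg)
      also have "\<dots> \<le> (\<Sum>z\<in>Z. norm (E N z))" by (rule norm_sum)
      also have "\<dots> = (\<Sum>z\<in>Z - far. norm (E N z)) + (\<Sum>z\<in>far. norm (E N z))"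
        using finZ by (intro sum.subset_diff) (auto simp: far_def)
      also have "(\<Sum>z\<in>far. norm (E N z)) \<le> (\<Sum>z\<in>Z. C / real T * real N)"
      proof -
        have "(\<Sum>z\<in>far. norm (E N z)) \<le> (\<Sum>z\<in>far. C / real T * real N)" using N by (intro sum_mono) auto
        also have "\<dots> \<le> (\<Sum>z\<in>Z. C / real T * real N)"
          using finZ C(1) by (intro sum_mono2) (auto simp: far_def)
        finally show ?thesis .
      qed
      also have "(\<Sum>z\<in>Z. C / real T * real N) = real N * ((real S)\<^sup>2 * C / real T)"
        by (simp add: Z_def power2_eq_square)
      also have "(\<Sum>z\<in>Z - far. norm (E N z)) \<le> (\<Sum>z\<in>Z - far. real N)"
      proof (rule sum_mono)
        fix z
        have "norm (E N z) \<le> (\<Sum>n=1..N. 1)" unfolding E_def by (rule sum_norm_le) simp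
        then show "norm (E N z) \<le> real N" by simp
      qed
      also have "\<dots> \<le> real (S * (2 * K)) * real N"
      proof -
        have "Z - far \<subseteq> (SIGMA s:{..<S}. {t. \<bar>int s - int t\<bar> < int K})"
          by (auto simp: Z_def far_def d_def)
        moreover have near: "{t. \<bar>int s - int t\<bar> < int K} \<subseteq> {Suc s - K..<s + K}" for s by auto
        then have fin: "finite {t. \<bar>int s - int t\<bar> < int K}" for s by (rule finite_subset) simp
        ultimately have "card (Z - far) \<le> card (SIGMA s:{..<S}. {t. \<bar>int s - int t\<bar> < int K})"
          by (intro card_mono) auto
        also have "\<dots> = (\<Sum>s<S. card {t. \<bar>int s - int t\<bar> < int K})" using fin by (intro card_SigmaI) auto
        also have "\<dots> \<le> (\<Sum>s<S. 2 * K)"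
        proof (rule sum_mono)
          fix s
          have "card {t. \<bar>int s - int t\<bar> < int K} \<le> card {Suc s - K..<s + K}" by (intro card_mono near) simp
          then show "card {t. \<bar>int s - int t\<bar> < int K} \<le> 2 * K" by simp
        qed
        finally have "card (Z - far) \<le> S * (2 * K)" by simp
        then show ?thesis unfolding sum_constant by (intro mult_right_mono) (simp_all flip: of_nat_mult)
      qed
      finally show "(\<Sum>n=1..N. (norm (\<Sum>s=1..S. ee (real s * (\<Sum>j\<in>J. of_int (m j) * alpha (p j) n))))\<^sup>2)
          \<le> real N * (2 * real S * real T ^ (card J + 1) + (real S)\<^sup>2 * C / real T)"
        by (simp add: X_def K_def algebra_simps)
    qed
  qed
  then show ?thesis using C(1) by blast
qed

section \<open>The theorem\<close>

text \<open>\<open>C\<close> does not depend on \<open>H\<close>, so the bound tends to 0 as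
  \<open>H\<close> grows, and the threshold for \<open>N\<close> precedes the choice of
  \<open>\<beta>\<close>.\<close>

lemma few_exceptions:
  fixes J :: "nat set" and p :: "nat \<Rightarrow> nat"
  assumes "finite J" "J \<noteq> {}" and p: "\<And>j. j \<in> J \<Longrightarrow> prime (p j) \<and> odd (p j)" and "inj_on p J"
  shows "\<exists>C\<ge>0. \<forall>H\<ge>1. \<forall>\<^sub>F N in sequentially. \<forall>\<beta> :: nat \<Rightarrow> nat \<Rightarrow> real.
    real (card {n \<in> {1..N}. \<not> (\<exists>s\<in>{1..10 ^ (10 * (card J)\<^sup>2 * H)}.
       \<forall>j\<in>J. frac (real s * alpha (p j) n + \<beta> j n) \<in> U (p j) H)}) \<le> real N * (C * (1 / 2) ^ H)"
proof -
  define r where "r = card J"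
  have r: "r \<ge> 1" using assms(1,2) by (simp add: r_def Suc_le_eq card_gt_0_iff)
  have p3: "p j \<ge> 3" if "j \<in> J" for j
  proof -
    have "p j \<ge> 2" "odd (p j)" using p[OF that] prime_ge_2_nat by auto
    then have "p j \<noteq> 2" by auto
    then show ?thesis using \<open>p j \<ge> 2\<close> by linarith
  qed
  obtain C where C: "C \<ge> 0" and ms: "\<And>(m :: nat \<Rightarrow> int) (T :: nat) S. (\<exists>i\<in>J. m i \<noteq> 0) \<Longrightarrow> T > 0 \<Longrightarrow>
    (\<forall>\<^sub>F N in sequentially. (\<Sum>n=1..N. (norm (\<Sum>s=1..S. ee (real s * (\<Sum>j\<in>J. of_int (m j) * alpha (p j) n))))\<^sup>2)
      \<le> real N * (2 * real S * real T ^ (card J + 1) + (real S)\<^sup>2 * C / real T))"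
    using mean_square_small[OF assms(1) p assms(4)] by blast
  have "\<forall>\<^sub>F N in sequentially. \<forall>\<beta> :: nat \<Rightarrow> nat \<Rightarrow> real.
    real (card {n \<in> {1..N}. \<not> (\<exists>s\<in>{1..10 ^ (10 * (card J)\<^sup>2 * H)}.
       \<forall>j\<in>J. frac (real s * alpha (p j) n + \<beta> j n) \<in> U (p j) H)}) \<le> real N * ((C + 3) * (1 / 2) ^ H)"
    if H: "H \<ge> 1" for H
  proof -
    define h where "h = r * H"
    define Z :: nat where "Z = 10 ^ h"
    define S where "S = Z ^ (10 * r)"
    define T where "T = Z ^ 3"
    \<comment> \<open>The relative size allowed to the exponential sums: against the total weight
      \<open>15 ^ h\<close> it leaves \<open>(1 / 2) ^ h\<close>. The exponent 3 in \<open>T\<close>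
      suffices because 10^3 is at least 30^2.\<close>
    define \<kappa> :: real where "\<kappa> = (1 / 30) ^ h"
    have Z1: "real Z \<ge> 1" by (simp add: Z_def)
    have pos: "real Z > 0" "real S > 0" "real T > 0" "\<kappa> > 0" by (auto simp: Z_def S_def T_def \<kappa>_def)
    have S_eq: "10 ^ (10 * (card J)\<^sup>2 * H) = S"
      by (simp add: S_def Z_def h_def r_def power2_eq_square mult_ac flip: power_mult)
    have \<kappa>Z: "1 \<le> \<kappa>\<^sup>2 * real Z ^ 3"
    proof -
      have swap: "(x ^ h) ^ k = (x ^ k) ^ h" for x :: real and k
        by (metis power_mult mult.commute)
      have "\<kappa>\<^sup>2 * real Z ^ 3 = ((1 / 30)\<^sup>2) ^ h * (10 ^ 3) ^ h"
        unfolding \<kappa>_def Z_def of_nat_power swap by simp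
      also have "\<dots> = ((1 / 30)\<^sup>2 * 10 ^ 3) ^ h" by (rule power_mult_distrib[symmetric])
      also have "\<dots> \<ge> 1" by (intro one_le_power) (simp add: power2_eq_square)
      finally show ?thesis .
    qed
    have Q: "2 * real S * real T ^ (r + 1) + (real S)\<^sup>2 * C / real T \<le> (real S)\<^sup>2 * \<kappa>\<^sup>2 * (C + 2)"
    proof -
      have "real T ^ (r + 1) = real Z ^ (3 * (r + 1)) * 1" by (simp only: T_def of_nat_power power_mult mult_1_right)
      also have "\<dots> \<le> real Z ^ (3 * (r + 1)) * (\<kappa>\<^sup>2 * real Z ^ 3)"
        by (intro mult_left_mono \<kappa>Z) simp
      also have "\<dots> = \<kappa>\<^sup>2 * real Z ^ (3 * (r + 1) + 3)" by (simp add: power_add)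
      \<comment> \<open>\<open>3 * (r + 1) + 3 \<le> 10 * r\<close> for all
        \<open>r \<ge> 1\<close>; this is where the factor 10 in the exponent of \<open>S\<close>
        enters.\<close>
      also have "\<dots> \<le> \<kappa>\<^sup>2 * real Z ^ (10 * r)"
        using r Z1 by (intro mult_left_mono power_increasing) auto
      finally have "real T ^ (r + 1) \<le> \<kappa>\<^sup>2 * real S" by (simp add: S_def)
      then have "2 * real S * real T ^ (r + 1) \<le> 2 * real S * (\<kappa>\<^sup>2 * real S)"
        by (intro mult_left_mono) auto
      moreover have "(real S)\<^sup>2 * C / real T \<le> (real S)\<^sup>2 * C * \<kappa>\<^sup>2"
      proof -
        have "1 / real T \<le> \<kappa>\<^sup>2" using \<kappa>Z pos(3) by (simp add: T_def field_simps)
        then have "(real S)\<^sup>2 * C * (1 / real T) \<le> (real S)\<^sup>2 * C * \<kappa>\<^sup>2"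
          using C by (intro mult_left_mono) auto
        then show ?thesis by simp
      qed
      ultimately show ?thesis by (simp add: algebra_simps power2_eq_square)
    qed
    have "\<exists>G W (N :: (nat \<times> nat \<Rightarrow> int) \<Rightarrow> nat \<Rightarrow> int). finite G \<and> (\<forall>g. W g \<ge> 0) \<and> (\<Sum>g\<in>G. W g) \<le> 15 ^ (card J * H) \<and>
      (\<forall>g\<in>G. \<exists>j\<in>J. N g j \<noteq> 0) \<and>
      (\<forall>S \<alpha> \<beta>. S \<ge> 1 \<longrightarrow>
        (\<Sum>g\<in>G. W g * norm (\<Sum>s=1..S. ee (real s * (\<Sum>j\<in>J. of_int (N g j) * \<alpha> j)))) \<le> real S / 2 \<longrightarrow>
        (\<exists>s\<in>{1..S}. \<forall>j\<in>J. frac (real s * \<alpha> j + \<beta> j) \<in> U (p j) H))"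
      by (rule exponential_sum_criterion[OF assms(1,2) H]) (rule p3)
    then obtain G W and Nf :: "(nat \<times> nat \<Rightarrow> int) \<Rightarrow> nat \<Rightarrow> int"
      where G: "finite G" "\<forall>g. W g \<ge> 0" "(\<Sum>g\<in>G. W g) \<le> 15 ^ (card J * H)" "\<forall>g\<in>G. \<exists>j\<in>J. Nf g j \<noteq> 0"
      and crit: "\<forall>S \<alpha> \<beta>. S \<ge> 1 \<longrightarrow>
        (\<Sum>g\<in>G. W g * norm (\<Sum>s=1..S. ee (real s * (\<Sum>j\<in>J. of_int (Nf g j) * \<alpha> j)))) \<le> real S / 2 \<longrightarrow>
        (\<exists>s\<in>{1..S}. \<forall>j\<in>J. frac (real s * \<alpha> j + \<beta> j) \<in> U (p j) H)"
      by (elim exE conjE)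
    define D where "D g n = norm (\<Sum>s=1..S. ee (real s * (\<Sum>j\<in>J. of_int (Nf g j) * alpha (p j) n)))" for g n
    have "\<forall>\<^sub>F N in sequentially. (\<Sum>n=1..N. (D g n)\<^sup>2)
        \<le> real N * (2 * real S * real T ^ (r + 1) + (real S)\<^sup>2 * C / real T)" if "g \<in> G" for g
      unfolding D_def r_def using G(4) that pos(3) by (intro ms) auto
    then have "\<forall>\<^sub>F N in sequentially. \<forall>g\<in>G. (\<Sum>n=1..N. (D g n)\<^sup>2)
        \<le> real N * (2 * real S * real T ^ (r + 1) + (real S)\<^sup>2 * C / real T)"
      using G(1) by (intro eventually_ball_finite) auto
    then show ?thesis
    proof (rule eventually_mono, intro allI)
      fix N and \<beta> :: "nat \<Rightarrow> nat \<Rightarrow> real"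
      assume N: "\<forall>g\<in>G. (\<Sum>n=1..N. (D g n)\<^sup>2)
        \<le> real N * (2 * real S * real T ^ (r + 1) + (real S)\<^sup>2 * C / real T)"
      define bad where "bad = {n \<in> {1..N}. \<not> (\<exists>s\<in>{1..S}. \<forall>j\<in>J. frac (real s * alpha (p j) n + \<beta> j n) \<in> U (p j) H)}"
      have bad_large: "(\<Sum>g\<in>G. W g * D g n) \<ge> real S / 2" if "n \<in> bad" for n
      proof (rule ccontr)
        assume "\<not> ?thesis"
        then have le: "(\<Sum>g\<in>G. W g * norm (\<Sum>s=1..S. ee (real s * (\<Sum>j\<in>J. of_int (Nf g j) * alpha (p j) n)))) \<le> real S / 2"
          unfolding D_def by linarith
        have "S \<ge> 1" using pos(2) by simp
        with crit le have "\<exists>s\<in>{1..S}. \<forall>j\<in>J. frac (real s * alpha (p j) n + \<beta> j n) \<in> U (p j) H"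
          by (elim allE[of _ S] allE[of _ "\<lambda>j. alpha (p j) n"] allE[of _ "\<lambda>j. \<beta> j n"]) simp
        then show False using that unfolding bad_def by blast
      qed
      have sumD: "(\<Sum>n=1..N. D g n) \<le> real N * real S * \<kappa> * (C + 3) / 2" if g: "g \<in> G" for g
      proof -
        \<comment> \<open>AM-GM balanced at the expected size \<open>S * \<kappa>\<close> passes
          from the mean square to the mean.\<close>
        have "D g n \<le> (real S * \<kappa> + (D g n)\<^sup>2 / (real S * \<kappa>)) / 2" for n
        proof -
          have "2 * (real S * \<kappa>) * D g n \<le> (real S * \<kappa>)\<^sup>2 + (D g n)\<^sup>2"
            by (rule sum_squares_bound)
          then show ?thesis using pos by (simp add: field_simps power2_eq_square)
        qed
        then have "(\<Sum>n=1..N. D g n) \<le> (\<Sum>n=1..N. (real S * \<kappa> + (D g n)\<^sup>2 / (real S * \<kappa>)) / 2)"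
          by (intro sum_mono) auto
        also have "\<dots> = (real N * (real S * \<kappa>) + (\<Sum>n=1..N. (D g n)\<^sup>2) / (real S * \<kappa>)) / 2"
          by (simp add: sum.distrib flip: sum_divide_distrib)
        also have "\<dots> \<le> (real N * (real S * \<kappa>) + (real N * ((real S)\<^sup>2 * \<kappa>\<^sup>2 * (C + 2))) / (real S * \<kappa>)) / 2"
        proof -
          have "(\<Sum>n=1..N. (D g n)\<^sup>2) \<le> real N * ((real S)\<^sup>2 * \<kappa>\<^sup>2 * (C + 2))"
            using N g mult_left_mono[OF Q, of "real N"] by fastforce
          then show ?thesis using pos by (intro divide_right_mono add_left_mono) auto
        qed
        also have "\<dots> = real N * real S * \<kappa> * (C + 3) / 2"
          using pos by (simp add: field_simps power2_eq_square)
        finally show ?thesis .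
      qed
      have "real (card bad) * (real S / 2) = (\<Sum>n\<in>bad. real S / 2)" by simp
      also have "\<dots> \<le> (\<Sum>n\<in>bad. \<Sum>g\<in>G. W g * D g n)" by (intro sum_mono bad_large)
      also have "\<dots> \<le> (\<Sum>n=1..N. \<Sum>g\<in>G. W g * D g n)"
        using G(2) by (intro sum_mono2) (auto simp: bad_def D_def intro!: sum_nonneg)
      also have "\<dots> = (\<Sum>g\<in>G. W g * (\<Sum>n=1..N. D g n))"
        by (subst sum.swap) (simp add: sum_distrib_left)
      also have "\<dots> \<le> (\<Sum>g\<in>G. W g * (real N * real S * \<kappa> * (C + 3) / 2))"
        using G(2) sumD by (intro sum_mono mult_left_mono) auto
      also have "\<dots> = (\<Sum>g\<in>G. W g) * (real N * real S * \<kappa> * (C + 3) / 2)" by (rule sum_distrib_right[symmetric])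
      also have "\<dots> \<le> 15 ^ h * (real N * real S * \<kappa> * (C + 3) / 2)"
        using G(3) pos C by (intro mult_right_mono) (auto simp: h_def r_def)
      also have "\<dots> = (15 ^ h * \<kappa>) * (real N * (C + 3)) * (real S / 2)" by simp
      also have "15 ^ h * \<kappa> = (1 / 2) ^ h" unfolding \<kappa>_def by (simp flip: power_mult_distrib)
      finally have "real (card bad) \<le> (1 / 2) ^ h * (real N * (C + 3))"
        using pos(2) by (simp add: mult_le_cancel_right)
      also have "\<dots> \<le> (1 / 2) ^ H * (real N * (C + 3))"
        using r C by (intro mult_right_mono power_decreasing) (auto simp: h_def)
      finally show "real (card {n \<in> {1..N}. \<not> (\<exists>s\<in>{1..10 ^ (10 * (card J)\<^sup>2 * H)}.
          \<forall>j\<in>J. frac (real s * alpha (p j) n + \<beta> j n) \<in> U (p j) H)}) \<le> real N * ((C + 3) * (1 / 2) ^ H)"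
        unfolding S_eq bad_def[symmetric] by (simp add: mult_ac)
    qed
  qed
  then show ?thesis using C by (intro exI[of _ "C + 3"]) auto
qed

lemma diagonal_choice:
  fixes P :: "nat \<Rightarrow> nat \<Rightarrow> bool"
  assumes "\<And>h. h \<ge> 1 \<Longrightarrow> \<forall>\<^sub>F N in sequentially. P h N"
  shows "\<exists>H :: nat \<Rightarrow> nat. (\<forall>N. H N \<ge> 1) \<and> filterlim H at_top sequentially \<and> (\<forall>\<^sub>F N in sequentially. P (H N) N)"
proof -
  have "\<forall>h. \<exists>M. h \<ge> 1 \<longrightarrow> (\<forall>N\<ge>M. P h N)"
    using assms unfolding eventually_sequentially by blast
  from choice[OF this] obtain M where M: "\<And>h N. h \<ge> 1 \<Longrightarrow> N \<ge> M h \<Longrightarrow> P h N" by blast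
  \<comment> \<open>\<open>H N\<close> will be the largest level whose threshold has been passed.
    Adding \<open>h\<close> to the threshold bounds the candidates by \<open>N\<close>, so the
    maximum exists; the default 1 keeps \<open>H N\<close> positive while there are none.\<close>
  define A where "A N = {h. 1 \<le> h \<and> h + M h \<le> N}" for N
  have fin: "finite (A N)" for N by (rule finite_subset[of _ "{..N}"]) (auto simp: A_def)
  define H where "H N = (if A N = {} then 1 else Max (A N))" for N
  have mem: "H N \<in> A N" if "A N \<noteq> {}" for N using Max_in[OF fin that] that by (simp add: H_def)
  have "H N \<ge> 1" for N
    using mem[of N] by (cases "A N = {}") (auto simp: A_def H_def)
  moreover have "filterlim H at_top sequentially"
    unfolding filterlim_at_top
  proof
    fix h
    have "H N \<ge> h" if "N \<ge> Suc h + M (Suc h)" for N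
    proof -
      have "Suc h \<in> A N" using that by (simp add: A_def)
      then have "A N \<noteq> {}" by blast
      have "Suc h \<le> Max (A N)" using \<open>Suc h \<in> A N\<close> fin by (intro Max_ge)
      then show ?thesis using \<open>A N \<noteq> {}\<close> by (simp add: H_def)
    qed
    then show "\<forall>\<^sub>F N in sequentially. h \<le> H N" unfolding eventually_sequentially by blast
  qed
  moreover have "P (H N) N" if "N \<ge> 1 + M 1" for N
  proof -
    have "1 \<in> A N" using that by (simp add: A_def)
    then have "H N \<in> A N" using mem by blast
    then show ?thesis using M[of "H N" N] by (simp add: A_def)
  qed
  then have "\<forall>\<^sub>F N in sequentially. P (H N) N" unfolding eventually_sequentially by blast
  ultimately show ?thesis by blast
qed

theorem theorem2:
  fixes r :: nat and p :: "nat \<Rightarrow> nat"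
  assumes "r \<ge> 1"
    and "\<And>i. i \<in> {1..r} \<Longrightarrow> prime (p i) \<and> odd (p i)"
    and "inj_on p {1..r}"
  shows "\<exists>H :: nat \<Rightarrow> nat.
    (\<forall>N\<ge>1. H N \<ge> 1) \<and> filterlim H at_top at_top \<and>
    (\<forall>\<beta> :: nat \<Rightarrow> nat \<Rightarrow> real. \<exists>e :: nat \<Rightarrow> real. e \<longlonglongrightarrow> 0 \<and>
      (\<forall>N\<ge>1. real (card {n \<in> {1..N}. \<exists>s :: int. 1 \<le> s \<and> s \<le> 10 ^ (10 * r\<^sup>2 * H N) \<and>
          (\<forall>j\<in>{1..r}. frac (real_of_int s * alpha (p j) n + \<beta> j n) \<in> U (p j) (H N))}) / real N
        \<ge> 1 - e N))"
proof -
  define good where "good h n b \<longleftrightarrow> (\<exists>s\<in>{1..10 ^ (10 * r\<^sup>2 * h)}.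
       \<forall>j\<in>{1..r}. frac (real s * alpha (p j) n + b j) \<in> U (p j) h)" for h n and b :: "nat \<Rightarrow> real"
  have "{1..r} \<noteq> {}" using assms(1) by auto
  from few_exceptions[OF _ this assms(2,3)] obtain C where C: "C \<ge> 0"
    and few: "\<And>h. h \<ge> 1 \<Longrightarrow> \<forall>\<^sub>F N in sequentially. \<forall>\<beta> :: nat \<Rightarrow> nat \<Rightarrow> real.
      real (card {n \<in> {1..N}. \<not> good h n (\<lambda>j. \<beta> j n)}) \<le> real N * (C * (1 / 2) ^ h)"
    unfolding good_def by auto
  obtain H :: "nat \<Rightarrow> nat" where H: "\<And>N. H N \<ge> 1" "filterlim H at_top sequentially"
    and ev: "\<forall>\<^sub>F N in sequentially. \<forall>\<beta> :: nat \<Rightarrow> nat \<Rightarrow> real.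
      real (card {n \<in> {1..N}. \<not> good (H N) n (\<lambda>j. \<beta> j n)}) \<le> real N * (C * (1 / 2) ^ H N)"
    using diagonal_choice[of "\<lambda>h N. \<forall>\<beta> :: nat \<Rightarrow> nat \<Rightarrow> real.
      real (card {n \<in> {1..N}. \<not> good h n (\<lambda>j. \<beta> j n)}) \<le> real N * (C * (1 / 2) ^ h)", OF few] by blast
  have "\<exists>e :: nat \<Rightarrow> real. e \<longlonglongrightarrow> 0 \<and>
      (\<forall>N\<ge>1. real (card {n \<in> {1..N}. \<exists>s :: int. 1 \<le> s \<and> s \<le> 10 ^ (10 * r\<^sup>2 * H N) \<and>
          (\<forall>j\<in>{1..r}. frac (real_of_int s * alpha (p j) n + \<beta> j n) \<in> U (p j) (H N))}) / real N
        \<ge> 1 - e N)" for \<beta> :: "nat \<Rightarrow> nat \<Rightarrow> real"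
  proof -
    \<comment> \<open>Taking the exact proportion of exceptions makes the inequality hold for every
      \<open>N \<ge> 1\<close>, also before the estimate sets in; only the convergence uses
      \<open>ev\<close>.\<close>
    define e where "e N = real (card {n \<in> {1..N}. \<not> good (H N) n (\<lambda>j. \<beta> j n)}) / real N" for N
    have "e \<longlonglongrightarrow> 0"
    proof (rule tendsto_sandwich[of "\<lambda>_. 0"])
      show "\<forall>\<^sub>F N in sequentially. e N \<le> C * (1 / 2) ^ H N"
        using ev eventually_gt_at_top[of 0]
        by eventually_elim (auto simp: e_def field_simps)
      have "(\<lambda>h. (1 / 2 :: real) ^ h) \<longlonglongrightarrow> 0" by (intro LIMSEQ_realpow_zero) auto
      from tendsto_mult_right_zero[OF filterlim_compose[OF this H(2)], of C]
      show "(\<lambda>N. C * (1 / 2) ^ H N) \<longlonglongrightarrow> 0" .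
    qed (auto simp: e_def)
    moreover have "real (card {n \<in> {1..N}. \<exists>s :: int. 1 \<le> s \<and> s \<le> 10 ^ (10 * r\<^sup>2 * H N) \<and>
          (\<forall>j\<in>{1..r}. frac (real_of_int s * alpha (p j) n + \<beta> j n) \<in> U (p j) (H N))}) / real N
        \<ge> 1 - e N" (is "real (card ?A) / real N \<ge> _") if N: "N \<ge> 1" for N
    proof -
      define B where "B = {n \<in> {1..N}. \<not> good (H N) n (\<lambda>j. \<beta> j n)}"
      have "{1..N} - B \<subseteq> ?A"
      proof
        fix n assume n: "n \<in> {1..N} - B"
        then have "good (H N) n (\<lambda>j. \<beta> j n)" by (simp add: B_def)
        then obtain s :: nat where s: "s \<in> {1..10 ^ (10 * r\<^sup>2 * H N)}"
          "\<forall>j\<in>{1..r}. frac (real s * alpha (p j) n + \<beta> j n) \<in> U (p j) (H N)"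
          unfolding good_def by blast
        have "int s \<le> int (10 ^ (10 * r\<^sup>2 * H N))" using s(1) by (simp only: of_nat_le_iff atLeastAtMost_iff)
        then have "1 \<le> int s \<and> int s \<le> 10 ^ (10 * r\<^sup>2 * H N)" using s(1) by simp
        then show "n \<in> ?A" using n s(2) by (auto intro!: exI[of _ "int s"])
      qed
      then have "card ({1..N} - B) \<le> card ?A" by (intro card_mono) auto
      moreover have "card ({1..N} - B) = N - card B"
        by (subst card_Diff_subset) (auto simp: B_def)
      ultimately have "real N - real (card B) \<le> real (card ?A)" by linarith
      then have "(real N - real (card B)) / real N \<le> real (card ?A) / real N" by (rule divide_right_mono) simp
      moreover have "(real N - real (card B)) / real N = 1 - e N"
        using N by (simp add: e_def B_def diff_divide_distrib)
      ultimately show ?thesis by linarith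
    qed
    ultimately show ?thesis by blast
  qed
  then show ?thesis using H by blast
qed

end
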